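(* Suppose that for every nonempty observable class $O_j$ there are a $\sigma$-finite measure $\lambda_j$ on $(O_j,\mathcal B(O_j))$ and a nonnegative jointly measurable function $(x',x,u)\mapsto q_j(x'\mid x,u)$ such that for every $(x,u)\in\mathcal X\times\mathcal U$, $$Q(C\cap O_j\mid x,u)=\int_{C\cap O_j}q_j(x'\mid x,u)\,\lambda_j(dx'),\qquad C\in\mathcal B(\mathcal X).$$ Let $t\ge0$. Then, on the event $\{Y_{t+1}=j,\ p_j(\pi_t,U_t)>0\}$, the filtered law satisfies $$\pi_{t+1}(dx')=z_{t+1}^{j}(x')\,\lambda_j(dx')$$ (almost surely), where $$\widetilde z_{t+1}^{j}(x'):=\mathbf 1_{O_j}(x')\int_{\mathcal X}q_j(x'\mid x,U_t)\,\pi_t(dx),\qquad z_{t+1}^{j}(x'):=\frac{\widetilde z_{t+1}^{j}(x')}{\int_{O_j}\widetilde z_{t+1}^{j}(y)\,\lambda_j(dy)}.$$ If, moreover, the prior law has a class-dependent density $z_t^k$ with respect to $\lambda_k$ on the currently observed class $O_k$ (that is, $\pi_t(dx)=z_t^k(x)\lambda_k(dx)$), then $$\widetilde z_{t+1}^{j}(x')=\mathbf 1_{O_j}(x')\int_{O_k}q_j(x'\mid x,U_t)\,z_t^k(x)\,\lambda_k(dx).$$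
   Context: Model. $(\Omega,\mathcal F,\mathbb P)$ is a complete probability space; $\mathcal X$ (states), $\mathcal U$ (actions), $\mathsf E$, $\mathsf V$ (noises) are standard Borel spaces; $\mathcal P(\mathcal X)$ is the set of probability measures on $(\mathcal X,\mathcal B(\mathcal X))$. $G:\mathcal X\times\mathcal U\times\mathsf E\times\mathsf V\to\mathcal X$ is Borel measurable and $X_{t+1}=G(X_t,U_t,\eta_{t+1},\varepsilon_{t+1})$ for $t\ge 0$, where $(\eta_t)_{t\ge1}$ is i.i.d. with law $\nu_\eta$ on $\mathsf E$, $(\varepsilon_t)_{t\ge1}$ is i.i.d. with law $\nu_\varepsilon$ on $\mathsf V$, and $X_0$, $(\eta_t)_t$, $(\varepsilon_t)_t$ are mutually independent. The controlled kernel is $Q(C\mid x,u)=\int_{\mathsf E}\int_{\mathsf V}\mathbf 1_C(G(x,u,e,v))\,\nu_\varepsilon(dv)\,\nu_\eta(de)$. Observations. $A_1,\dots,A_m$ is a finite measurable partition of $\mathcal X$; $O_j=\bigcup_{i\in J_j}A_i$ for $j=1,\dots,r$, with $J_1,\dots,J_r\subseteq\{1,\dots,m\}$ nonempty and pairwise disjoint; $O_{r+1}=\mathcal X\setminus\bigcup_{j\le r}O_j$ (index $r+1$ is omitted if this is empty). The observation is $Y_t=j\iff X_t\in O_j$. The information is $\mathcal H_t=\sigma(Y_0,U_0,Y_1,U_1,\dots,U_{t-1},Y_t)$, $\mathcal H_0=\sigma(Y_0)$, and $U_t$ is $\mathcal H_t$-measurable for all $t$. $\pi_t(C)=\mathbb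 P(X_t\in C\mid\mathcal H_t)$ denotes a regular version with values in $\mathcal P(\mathcal X)$. Notation. For $\mu\in\mathcal P(\mathcal X)$, $u\in\mathcal U$: $(\mathcal L_u\mu)(C)=\int_{\mathcal X}Q(C\mid x,u)\,\mu(dx)$ and $p_j(\mu,u)=(\mathcal L_u\mu)(O_j)$. *)

theory Defs
  imports "HOL-Probability.Probability"
begin

definition standard_borel :: "'a measure \<Rightarrow> bool" where
  "standard_borel N \<longleftrightarrow>
     (\<exists>T. topspace T = space N \<and> completely_metrizable_space T \<and> second_countable T \<and>
          sets N = sigma_sets (space N) {S. openin T S})"

definition controlled_kernel ::
    "'e measure \<Rightarrow> 'v measure \<Rightarrow> ('x \<times> 'u \<times> 'e \<times> 'v \<Rightarrow> 'x) \<Rightarrow> 'x set \<Rightarrow> 'x \<Rightarrow> 'u \<Rightarrow> ennreal" where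
  "controlled_kernel \<nu>\<eta> \<nu>\<epsilon> G C x u =
     (\<integral>\<^sup>+e. (\<integral>\<^sup>+v. indicator C (G (x, u, e, v)) \<partial>\<nu>\<epsilon>) \<partial>\<nu>\<eta>)"

definition predicted_law ::
    "'e measure \<Rightarrow> 'v measure \<Rightarrow> ('x \<times> 'u \<times> 'e \<times> 'v \<Rightarrow> 'x) \<Rightarrow> 'u \<Rightarrow> 'x measure \<Rightarrow> 'x set \<Rightarrow> ennreal" where
  "predicted_law \<nu>\<eta> \<nu>\<epsilon> G u \<mu> C = (\<integral>\<^sup>+x. controlled_kernel \<nu>\<eta> \<nu>\<epsilon> G C x u \<partial>\<mu>)"

text \<open>The observable classes carry the indices \<open>1, \<dots>, r + 1\<close>, the last one being the
  remainder; the index \<open>r + 1\<close> is dropped when the remainder is empty.\<close>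

definition obs_class ::
    "'x measure \<Rightarrow> (nat \<Rightarrow> 'x set) \<Rightarrow> (nat \<Rightarrow> nat set) \<Rightarrow> nat \<Rightarrow> nat \<Rightarrow> 'x set" where
  "obs_class MX A J r j =
     (if j = r + 1 then space MX - (\<Union>l\<in>{1..r}. \<Union>i\<in>J l. A i) else (\<Union>i\<in>J j. A i))"

definition class_indices ::
    "'x measure \<Rightarrow> (nat \<Rightarrow> 'x set) \<Rightarrow> (nat \<Rightarrow> nat set) \<Rightarrow> nat \<Rightarrow> nat set" where
  "class_indices MX A J r =
     {1..r} \<union> (if obs_class MX A J r (r + 1) = {} then {} else {r + 1})"

text \<open>The information \<open>\<sigma>(Y\<^sub>0, U\<^sub>0, \<dots>, U\<^bsub>t-1\<^esub>, Y\<^sub>t)\<close>, not completed by null sets; it is a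
  measurable space, the measure attached to it being irrelevant.\<close>

definition information ::
    "'w measure \<Rightarrow> 'u measure \<Rightarrow> (nat \<Rightarrow> 'w \<Rightarrow> nat) \<Rightarrow> (nat \<Rightarrow> 'w \<Rightarrow> 'u) \<Rightarrow> nat \<Rightarrow> 'w measure" where
  "information M MU Y U t =
     sigma (space M)
       ({Y s -` B \<inter> space M | s B. s \<le> t} \<union>
        {U s -` B \<inter> space M | s B. s < t \<and> B \<in> sets MU})"

locale controlled_observation_model = prob_space M + complete_measure M
  for M :: "'w measure" +
  fixes MX :: "'x measure" and MU :: "'u measure" and ME :: "'e measure" and MV :: "'v measure"
    and G :: "'x \<times> 'u \<times> 'e \<times> 'v \<Rightarrow> 'x"
    and \<nu>\<eta> :: "'e measure" and \<nu>\<epsilon> :: "'v measure"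
    and X :: "nat \<Rightarrow> 'w \<Rightarrow> 'x" and U :: "nat \<Rightarrow> 'w \<Rightarrow> 'u"
    and \<eta> :: "nat \<Rightarrow> 'w \<Rightarrow> 'e" and \<epsilon> :: "nat \<Rightarrow> 'w \<Rightarrow> 'v"
    and A :: "nat \<Rightarrow> 'x set" and m :: nat and J :: "nat \<Rightarrow> nat set" and r :: nat
    and Y :: "nat \<Rightarrow> 'w \<Rightarrow> nat" and \<pi> :: "nat \<Rightarrow> 'w \<Rightarrow> 'x measure"
  assumes borel_X: "standard_borel MX" and borel_U: "standard_borel MU"
    and borel_E: "standard_borel ME" and borel_V: "standard_borel MV"
    and G_measurable: "G \<in> measurable (MX \<Otimes>\<^sub>M MU \<Otimes>\<^sub>M ME \<Otimes>\<^sub>M MV) MX"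
    and law_eta: "\<nu>\<eta> \<in> space (prob_algebra ME)"
    and law_eps: "\<nu>\<epsilon> \<in> space (prob_algebra MV)"
    and initial_measurable: "X 0 \<in> measurable M MX"
    and dynamics:
      "\<And>t \<omega>. \<omega> \<in> space M \<Longrightarrow> X (Suc t) \<omega> = G (X t \<omega>, U t \<omega>, \<eta> (Suc t) \<omega>, \<epsilon> (Suc t) \<omega>)"
    and eta_indep: "indep_vars (\<lambda>_. ME) \<eta> {1..}"
    and eta_law: "\<And>t. t \<ge> 1 \<Longrightarrow> distr M ME (\<eta> t) = \<nu>\<eta>"
    and eps_indep: "indep_vars (\<lambda>_. MV) \<epsilon> {1..}"
    and eps_law: "\<And>t. t \<ge> 1 \<Longrightarrow> distr M MV (\<epsilon> t) = \<nu>\<epsilon>"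
    \<comment> \<open>mutual independence of three objects of different types, via the generated
        \<open>\<sigma>\<close>-algebras\<close>
    and mutual_indep:
      "indep_sets (\<lambda>i. [sets (vimage_algebra (space M) (X 0) MX),
           sets (vimage_algebra (space M) (\<lambda>\<omega>. \<lambda>t\<in>{1..}. \<eta> t \<omega>) (PiM {1..} (\<lambda>_. ME))),
           sets (vimage_algebra (space M) (\<lambda>\<omega>. \<lambda>t\<in>{1..}. \<epsilon> t \<omega>) (PiM {1..} (\<lambda>_. MV)))] ! i)
         {..<3::nat}"
    and partition_measurable: "\<And>i. i \<in> {1..m} \<Longrightarrow> A i \<in> sets MX"
    and partition_disjoint: "disjoint_family_on A {1..m}"
    and partition_cover: "(\<Union>i\<in>{1..m}. A i) = space MX"
    and J_subset: "\<And>j. j \<in> {1..r} \<Longrightarrow> J j \<subseteq> {1..m}"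
    and J_nonempty: "\<And>j. j \<in> {1..r} \<Longrightarrow> J j \<noteq> {}"
    and J_disjoint: "disjoint_family_on J {1..r}"
    and Y_in: "\<And>t \<omega>. \<omega> \<in> space M \<Longrightarrow> Y t \<omega> \<in> class_indices MX A J r"
    and Y_iff: "\<And>t \<omega> j. \<omega> \<in> space M \<Longrightarrow> j \<in> class_indices MX A J r \<Longrightarrow>
        Y t \<omega> = j \<longleftrightarrow> X t \<omega> \<in> obs_class MX A J r j"
    and control_adapted: "\<And>t. U t \<in> measurable (information M MU Y U t) MU"
    and filter_kernel: "\<And>t. \<pi> t \<in> measurable (information M MU Y U t) (prob_algebra MX)"
    and filter_cond_prob: "\<And>t C. C \<in> sets MX \<Longrightarrow>
        AE \<omega> in M. measure (\<pi> t \<omega>) C =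
          real_cond_exp M (information M MU Y U t) (\<lambda>\<omega>. indicator C (X t \<omega>)) \<omega>"

text \<open>\<open>\<mu>(dx) = f(x) lam(dx)\<close>, where \<open>lam\<close> lives on the subset \<open>S\<close> of the space of \<open>\<mu>\<close>; in
  particular \<open>\<mu>\<close> vanishes outside \<open>S\<close>.\<close>

definition has_class_density ::
    "'x measure \<Rightarrow> 'x set \<Rightarrow> 'x measure \<Rightarrow> ('x \<Rightarrow> ennreal) \<Rightarrow> bool" where
  "has_class_density \<mu> S lam f \<longleftrightarrow>
     f \<in> borel_measurable lam \<and> (\<forall>C\<in>sets \<mu>. emeasure \<mu> C = (\<integral>\<^sup>+x\<in>C \<inter> S. f x \<partial>lam))"

text \<open>The integral below may be infinite on a null set of \<open>x'\<close>, so the densities take values in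
  \<^typ>\<open>ennreal\<close>. The parameter \<open>q\<close> is the density of one class, \<open>q (x', x, u) = q\<^sub>j(x' | x, u)\<close>.\<close>

definition unnorm_density ::
    "'x set \<Rightarrow> ('x \<times> 'x \<times> 'u \<Rightarrow> real) \<Rightarrow> 'x measure \<Rightarrow> 'u \<Rightarrow> 'x \<Rightarrow> ennreal" where
  "unnorm_density S q \<mu> u x' = indicator S x' * (\<integral>\<^sup>+x. ennreal (q (x', x, u)) \<partial>\<mu>)"

definition norm_density ::
    "'x set \<Rightarrow> 'x measure \<Rightarrow> ('x \<times> 'x \<times> 'u \<Rightarrow> real) \<Rightarrow> 'x measure \<Rightarrow> 'u \<Rightarrow> 'x \<Rightarrow> ennreal" where
  "norm_density S lam q \<mu> u x' =
     unnorm_density S q \<mu> u x' / (\<integral>\<^sup>+y\<in>S. unnorm_density S q \<mu> u y \<partial>lam)"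

end

theory Submission
  imports Defs
begin

text \<open>
  The recursion is Bayes' rule in two steps. Given the information at time \<open>t\<close>, the state \<open>X t\<close> has
  law \<open>\<pi> t\<close> and the noises of time \<open>t + 1\<close> are fresh, so the conditional law of \<open>X (t + 1)\<close> is the
  predicted law (lemma \<open>prediction\<close>). The control \<open>U t\<close> is already a function of the information at
  time \<open>t\<close>, hence the only new information is \<open>Y (t + 1)\<close>, which is discrete:
  on \<open>{Y (t + 1) = j}\<close> every event of the information at time \<open>t + 1\<close> has the same trace as an event
  of the information at time \<open>t\<close>
  (\<open>info_next_on_observation\<close>). Conditioning further on this event of conditional probability
  \<open>p\<^sub>j(\<pi> t, U t)\<close> therefore amounts to restricting the predicted law to the \<open>j\<close>-th class and dividing
  by \<open>p\<^sub>j(\<pi> t, U t)\<close> (\<open>bayes_step\<close>). By Tonelli, the predicted law restricted to the class has the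
  unnormalised density with respect to \<open>lam j\<close> (\<open>nn_integral_unnorm_density\<close>), and its mass is the
  normalising constant.

  Three points need care. Freshness of the noises has to be extracted from the independence
  hypotheses, which speak of whole sequences: the preimage systems of \<open>X 0\<close> and of all single
  noises form one independent family, which is then regrouped into past and next noise; that the
  information at time \<open>t\<close> is generated by the past is an induction along the closed loop
  \<open>X \<rightarrow> Y \<rightarrow> U \<rightarrow> X\<close>. Conditional probabilities of a single set have to be
  promoted to integrals of functions depending jointly on the information and the state
  (\<open>filter_disintegration\<close>). Finally, Bayes' rule holds outside a null set that depends on the
  target set; a countable \<open>\<inter>\<close>-stable generator of the state space gives one null set for all of them.

  The second claim is pointwise: integrating against a law with density \<open>z\<close> is integrating with the
  weight \<open>z\<close>.
\<close>

section \<open>Countable generators of standard Borel spaces\<close>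

text \<open>The finite intersections of a countable base do: they are open, and every open set is a
  countable union of base sets.\<close>
lemma standard_borel_countable_generator:
  assumes "standard_borel N"
  obtains P where "countable P" "Int_stable P" "P \<subseteq> Pow (space N)" "space N \<in> P"
    "sets N = sigma_sets (space N) P"
proof -
  obtain T where T: "topspace T = space N" "second_countable T"
      "sets N = sigma_sets (space N) {S. openin T S}"
    using assms unfolding standard_borel_def by blast
  obtain \<B> where \<B>: "countable \<B>" "\<And>V. V \<in> \<B> \<Longrightarrow> openin T V"
      "\<And>U x. openin T U \<Longrightarrow> x \<in> U \<Longrightarrow> \<exists>V\<in>\<B>. x \<in> V \<and> V \<subseteq> U"
    using T(2) unfolding second_countable_def by metis
  define P where "P = (\<lambda>F. space N \<inter> \<Inter>F) ` {F. F \<subseteq> \<B> \<and> finite F}"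
  have P_I: "space N \<inter> \<Inter>F \<in> P" if "F \<subseteq> \<B>" "finite F" for F
    using that unfolding P_def by blast
  have V_eq: "space N \<inter> \<Inter>{V} = V" if "V \<in> \<B>" for V
    using openin_subset[OF \<B>(2)[OF that]] T(1) by auto
  show ?thesis
  proof
    have "countable {F. F \<subseteq> \<B> \<and> finite F}"
      using countable_Collect_finite_subset[OF \<B>(1)] by (simp add: conj_commute)
    then show "countable P" unfolding P_def by blast
    show "Int_stable P"
    proof (rule Int_stableI)
      fix a b assume "a \<in> P" "b \<in> P"
      then obtain F F' where F: "F \<subseteq> \<B>" "finite F" "a = space N \<inter> \<Inter>F"
        "F' \<subseteq> \<B>" "finite F'" "b = space N \<inter> \<Inter>F'"
        unfolding P_def by blast
      then have "a \<inter> b = space N \<inter> \<Inter>(F \<union> F')" by blast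
      then show "a \<inter> b \<in> P" using P_I[of "F \<union> F'"] F by simp
    qed
    show sub: "P \<subseteq> Pow (space N)" unfolding P_def by blast
    show "space N \<in> P" using P_I[of "{}"] by simp
    have open_P: "openin T C" if C: "C \<in> P" for C
    proof -
      obtain F where F: "F \<subseteq> \<B>" "finite F" "C = space N \<inter> \<Inter>F"
        using C by (auto simp: P_def)
      have "openin T (topspace T \<inter> \<Inter>F)"
        using F(2) \<B>(2) F(1) by (intro openin_Int_Inter) auto
      then show ?thesis by (simp only: F(3) T(1))
    qed
    show "sets N = sigma_sets (space N) P"
      unfolding T(3)
    proof (rule sigma_sets_eqI)
      fix S assume "S \<in> {S. openin T S}"
      then have "openin T S" by simp
      then have "S = \<Union>{V\<in>\<B>. V \<subseteq> S}" using \<B>(3) by blast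
      also have "\<dots> \<in> sigma_sets (space N) P"
      proof (rule sigma_sets_UNION)
        show "countable {V\<in>\<B>. V \<subseteq> S}" using \<B>(1) by simp
        fix V assume "V \<in> {V\<in>\<B>. V \<subseteq> S}"
        then show "V \<in> sigma_sets (space N) P"
          using P_I[of "{V}"] V_eq by (auto intro!: sigma_sets.Basic)
      qed
      finally show "S \<in> sigma_sets (space N) P" .
    next
      fix C assume "C \<in> P"
      then show "C \<in> sigma_sets (space N) {S. openin T S}"
        using open_P by (auto intro!: sigma_sets.Basic)
    qed
  qed
qed

section \<open>Laws with a density on one class\<close>

text \<open>The law \<open>f(x) lam(dx)\<close> as a measure on the whole space \<open>N\<close>; the identity map extends a measure
  carried by a class by zero. It lets \<^const>\<open>has_class_density\<close> be read as an equation
  between measures.\<close>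
definition class_law :: "'x measure \<Rightarrow> 'x measure \<Rightarrow> ('x \<Rightarrow> ennreal) \<Rightarrow> 'x measure" where
  "class_law N lam f = distr (density lam f) N (\<lambda>x. x)"

lemma
  assumes S: "S \<in> sets N" and lam: "sets lam = sets (restrict_space N S)"
    and f: "f \<in> borel_measurable lam"
  shows sets_class_law: "sets (class_law N lam f) = sets N"
    and nn_integral_class_law: "g \<in> borel_measurable N \<Longrightarrow>
      (\<integral>\<^sup>+x. g x \<partial>class_law N lam f) = (\<integral>\<^sup>+x\<in>S. g x * f x \<partial>lam)"
    and emeasure_class_law: "C \<in> sets N \<Longrightarrow>
      emeasure (class_law N lam f) C = (\<integral>\<^sup>+x\<in>C \<inter> S. f x \<partial>lam)"
proof -
  show "sets (class_law N lam f) = sets N" by (simp add: class_law_def)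
  have sp: "space lam = S"
    using sets_eq_imp_space_eq[OF lam] sets.sets_into_space[OF S] by (auto simp: space_restrict_space)
  have [measurable]: "(\<lambda>x. x) \<in> measurable lam N"
    using lam by (simp cong: measurable_cong_sets add: measurable_restrict_space1)
  note f[measurable]
  have id_d: "(\<lambda>x. x) \<in> measurable (density lam f) N" by simp
  show int: "(\<integral>\<^sup>+x. g x \<partial>class_law N lam f) = (\<integral>\<^sup>+x\<in>S. g x * f x \<partial>lam)"
    if [measurable]: "g \<in> borel_measurable N" for g
  proof -
    have [measurable]: "g \<in> borel_measurable lam"
      by (rule measurable_compose[of "\<lambda>x. x" lam N]) measurable
    show ?thesis
      unfolding class_law_def
      by (simp add: nn_integral_distr[OF id_d] nn_integral_density ac_simps)
         (auto simp: sp intro!: nn_integral_cong)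
  qed
  show "emeasure (class_law N lam f) C = (\<integral>\<^sup>+x\<in>C \<inter> S. f x \<partial>lam)" if "C \<in> sets N"
  proof -
    have "emeasure (class_law N lam f) C = (\<integral>\<^sup>+x. indicator C x \<partial>class_law N lam f)"
      using that by (simp add: class_law_def)
    also have "\<dots> = (\<integral>\<^sup>+x\<in>S. indicator C x * f x \<partial>lam)"
      using that by (intro int) simp
    also have "\<dots> = (\<integral>\<^sup>+x\<in>C \<inter> S. f x \<partial>lam)"
      by (intro nn_integral_cong) (auto simp: indicator_def)
    finally show ?thesis .
  qed
qed

lemma has_class_density_iff:
  assumes "S \<in> sets N" "sets lam = sets (restrict_space N S)" "sets \<mu> = sets N"
  shows "has_class_density \<mu> S lam f \<longleftrightarrow> f \<in> borel_measurable lam \<and> \<mu> = class_law N lam f"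
proof -
  have "(\<forall>C\<in>sets \<mu>. emeasure \<mu> C = (\<integral>\<^sup>+x\<in>C \<inter> S. f x \<partial>lam)) \<longleftrightarrow> \<mu> = class_law N lam f"
    if f: "f \<in> borel_measurable lam"
  proof
    assume "\<forall>C\<in>sets \<mu>. emeasure \<mu> C = (\<integral>\<^sup>+x\<in>C \<inter> S. f x \<partial>lam)"
    then show "\<mu> = class_law N lam f"
      using emeasure_class_law[OF assms(1,2) f] sets_class_law[OF assms(1,2) f] assms(3)
      by (intro measure_eqI) auto
  next
    assume "\<mu> = class_law N lam f"
    then show "\<forall>C\<in>sets \<mu>. emeasure \<mu> C = (\<integral>\<^sup>+x\<in>C \<inter> S. f x \<partial>lam)"
      using emeasure_class_law[OF assms(1,2) f] sets_class_law[OF assms(1,2) f]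
      by auto
  qed
  then show ?thesis unfolding has_class_density_def by blast
qed

text \<open>A density only has to be tested on an \<open>\<inter>\<close>-stable generator. With a countable generator this
  turns an almost sure statement for each set into an almost sure statement for all sets.\<close>
lemma has_class_density_if_generator:
  assumes P: "Int_stable P" "P \<subseteq> Pow (space N)" "space N \<in> P" "sets N = sigma_sets (space N) P"
    and S: "S \<in> sets N" and lam: "sets lam = sets (restrict_space N S)"
    and \<mu>: "\<mu> \<in> space (prob_algebra N)" and f: "f \<in> borel_measurable lam"
    and eq: "\<And>C. C \<in> P \<Longrightarrow> emeasure \<mu> C = (\<integral>\<^sup>+x\<in>C \<inter> S. f x \<partial>lam)"
  shows "has_class_density \<mu> S lam f"
proof -
  have sets_\<mu>: "sets \<mu> = sets N" and "prob_space \<mu>"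
    using \<mu> by (auto simp: space_prob_algebra)
  interpret prob_space \<mu> by fact
  have "\<mu> = class_law N lam f"
  proof (rule measure_eqI_generator_eq[OF P(1,2), where A = "\<lambda>_. space N"])
    fix C assume "C \<in> P"
    moreover from this have "C \<in> sets N" using P(4) by auto
    ultimately show "emeasure \<mu> C = emeasure (class_law N lam f) C"
      using eq emeasure_class_law[OF S lam f] by simp
  qed (use P sets_\<mu> sets_class_law[OF S lam f] in auto)
  then show ?thesis using has_class_density_iff[OF S lam sets_\<mu>] f by simp
qed

text \<open>Tonelli's theorem: if \<open>q(x', x, u)\<close> is the density in \<open>x'\<close> of a kernel, then averaging the kernel
  over \<open>\<mu>(dx)\<close> gives a measure whose density is the average of \<open>q\<close>.\<close>
lemma
  fixes q :: "'x \<times> 'x \<times> 'u \<Rightarrow> real"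
  assumes S: "S \<in> sets N" and lam: "sets lam = sets (restrict_space N S)" "sigma_finite_measure lam"
    and q: "q \<in> borel_measurable (restrict_space N S \<Otimes>\<^sub>M N \<Otimes>\<^sub>M K)"
    and \<mu>: "\<mu> \<in> space (prob_algebra N)" and u: "u \<in> space K"
  shows unnorm_density_measurable: "unnorm_density S q \<mu> u \<in> borel_measurable lam"
    and nn_integral_unnorm_density: "C \<in> sets N \<Longrightarrow>
      (\<integral>\<^sup>+x'\<in>C \<inter> S. unnorm_density S q \<mu> u x' \<partial>lam) =
      (\<integral>\<^sup>+x. (\<integral>\<^sup>+x'\<in>C \<inter> S. ennreal (q (x', x, u)) \<partial>lam) \<partial>\<mu>)"
proof -
  have \<mu>': "sets \<mu> = sets N" "prob_space \<mu>" using \<mu> by (auto simp: space_prob_algebra)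
  interpret \<mu>: prob_space \<mu> by fact
  interpret lam: sigma_finite_measure lam by fact
  interpret pair_sigma_finite lam \<mu> ..
  note lam(1)[measurable_cong] \<mu>'(1)[measurable_cong] q[measurable] u[measurable]
  have q_u[measurable]: "(\<lambda>(x', x). ennreal (q (x', x, u))) \<in> borel_measurable (lam \<Otimes>\<^sub>M \<mu>)"
    by measurable
  have [measurable]: "S \<in> sets lam" "\<And>C. C \<in> sets N \<Longrightarrow> C \<inter> S \<in> sets lam"
    using S lam(1) by (auto simp: sets_restrict_space)
  show m: "unnorm_density S q \<mu> u \<in> borel_measurable lam"
    unfolding unnorm_density_def by measurable
  show "(\<integral>\<^sup>+x'\<in>C \<inter> S. unnorm_density S q \<mu> u x' \<partial>lam) =
      (\<integral>\<^sup>+x. (\<integral>\<^sup>+x'\<in>C \<inter> S. ennreal (q (x', x, u)) \<partial>lam) \<partial>\<mu>)" if [measurable]: "C \<in> sets N"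
  proof -
    have "(\<integral>\<^sup>+x'\<in>C \<inter> S. unnorm_density S q \<mu> u x' \<partial>lam) =
        (\<integral>\<^sup>+x'. (\<integral>\<^sup>+x. ennreal (q (x', x, u)) * indicator (C \<inter> S) x' \<partial>\<mu>) \<partial>lam)"
    proof (rule nn_integral_cong)
      fix x' assume [measurable]: "x' \<in> space lam"
      have "(\<integral>\<^sup>+x. ennreal (q (x', x, u)) * indicator (C \<inter> S) x' \<partial>\<mu>) =
          (\<integral>\<^sup>+x. ennreal (q (x', x, u)) \<partial>\<mu>) * indicator (C \<inter> S) x'"
        by (rule nn_integral_multc) measurable
      then show "unnorm_density S q \<mu> u x' * indicator (C \<inter> S) x' =
          (\<integral>\<^sup>+x. ennreal (q (x', x, u)) * indicator (C \<inter> S) x' \<partial>\<mu>)"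
        by (auto simp: unnorm_density_def indicator_def)
    qed
    also have "\<dots> = (\<integral>\<^sup>+x. (\<integral>\<^sup>+x'\<in>C \<inter> S. ennreal (q (x', x, u)) \<partial>lam) \<partial>\<mu>)"
      by (rule Fubini'[symmetric]) measurable
    finally show ?thesis .
  qed
qed

section \<open>Independence lemmas\<close>

text \<open>Independent \<open>\<sigma>\<close>-algebras make the joint law of two variables, possibly of different value
  types, the product law: both sides agree on rectangles.\<close>
lemma (in prob_space) distr_Pair_eq_pair_measure:
  assumes ind: "indep_set (sigma_sets (space M) A) (sigma_sets (space M) B)"
    and Z: "Z \<in> measurable (sigma (space M) A) S" and W: "W \<in> measurable (sigma (space M) B) T"
  shows "distr M (S \<Otimes>\<^sub>M T) (\<lambda>\<omega>. (Z \<omega>, W \<omega>)) = distr M S Z \<Otimes>\<^sub>M distr M T W"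
proof -
  have A: "A \<subseteq> events" "B \<subseteq> events"
    using indep_setD_ev1[OF ind] indep_setD_ev2[OF ind] by (auto intro: sigma_sets.Basic)
  have gen: "f -` C \<inter> space M \<in> sigma_sets (space M) D"
    if "f \<in> measurable (sigma (space M) D) N" "D \<subseteq> events" "C \<in> sets N" for f :: "'a \<Rightarrow> 'z" and N C D
    using measurable_sets[OF that(1,3)] that(2) sets.space_closed[of M]
    by (simp add: space_measure_of_conv subset_trans[OF that(2)])
  have rv: "f \<in> measurable M N"
    if f: "f \<in> measurable (sigma (space M) D) N" and D: "D \<subseteq> events" for f :: "'a \<Rightarrow> 'z" and N D
  proof -
    have "id \<in> measurable M (sigma (space M) D)"
      using D sets.space_closed by (intro measurable_measure_of) auto
    from measurable_comp[OF this f] show ?thesis by simp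
  qed
  have Z_rv[measurable]: "Z \<in> measurable M S" and W_rv[measurable]: "W \<in> measurable M T"
    using rv[OF Z A(1)] rv[OF W A(2)] by auto
  interpret Z: prob_space "distr M S Z" by (rule prob_space_distr) fact
  interpret W: prob_space "distr M T W" by (rule prob_space_distr) fact
  have "distr M S Z \<Otimes>\<^sub>M distr M T W = distr M (S \<Otimes>\<^sub>M T) (\<lambda>\<omega>. (Z \<omega>, W \<omega>))"
  proof (rule pair_measure_eqI)
    fix C D assume "C \<in> sets (distr M S Z)" "D \<in> sets (distr M T W)"
    then have [measurable]: "C \<in> sets S" "D \<in> sets T" by auto
    have "emeasure (distr M (S \<Otimes>\<^sub>M T) (\<lambda>\<omega>. (Z \<omega>, W \<omega>))) (C \<times> D) =
        emeasure M ((Z -` C \<inter> space M) \<inter> (W -` D \<inter> space M))"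
      by (subst emeasure_distr) (auto intro!: arg_cong[where f = "emeasure M"])
    also have "\<dots> = ennreal (prob (Z -` C \<inter> space M) * prob (W -` D \<inter> space M))"
      using indep_setD[OF ind gen[OF Z A(1)] gen[OF W A(2)]] by (simp add: emeasure_eq_measure)
    also have "\<dots> = emeasure (distr M S Z) C * emeasure (distr M T W) D"
      by (simp add: emeasure_distr emeasure_eq_measure ennreal_mult)
    finally show "emeasure (distr M S Z) C * emeasure (distr M T W) D =
        emeasure (distr M (S \<Otimes>\<^sub>M T) (\<lambda>\<omega>. (Z \<omega>, W \<omega>))) (C \<times> D)" by simp
  qed (simp_all add: Z.sigma_finite_measure_axioms W.sigma_finite_measure_axioms)
  then show ?thesis by simp
qed

text \<open>Finitely many events, one for each of some members of an independent family, intersect in an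
  event of the whole sequence. This mediates between independence inside a noise sequence and
  independence of the sequence from other objects. The intersection with the sample space covers
  the empty index set.\<close>
lemma (in prob_space) indep_vars_finite_Int:
  assumes ind: "indep_vars (\<lambda>_. N) Z I" and fin: "finite a" and a: "a \<subseteq> I"
    and A: "\<And>s. s \<in> a \<Longrightarrow> A s \<in> {Z s -` B \<inter> space M | B. B \<in> sets N}"
  shows "space M \<inter> (\<Inter>s\<in>a. A s) \<in>
      sets (vimage_algebra (space M) (\<lambda>\<omega>. \<lambda>s\<in>I. Z s \<omega>) (PiM I (\<lambda>_. N)))"
    and "prob (space M \<inter> (\<Inter>s\<in>a. A s)) = (\<Prod>s\<in>a. prob (A s))"
proof -
  let ?V = "vimage_algebra (space M) (\<lambda>\<omega>. \<lambda>s\<in>I. Z s \<omega>) (PiM I (\<lambda>_. N))"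
  have rv: "Z s \<in> measurable M N" if "s \<in> I" for s
    using ind that by (auto simp: indep_vars_def)
  have seq: "(\<lambda>\<omega>. \<lambda>s\<in>I. Z s \<omega>) \<in> measurable ?V (PiM I (\<lambda>_. N))"
    using measurable_space[OF rv] by (intro measurable_vimage_algebra1) (auto simp: space_PiM)
  have comp: "Z s \<in> measurable ?V N" if "s \<in> I" for s
    using measurable_compose[OF seq measurable_component_singleton[OF that]] that by simp
  have sub: "A s \<subseteq> space M" if "s \<in> a" for s using A[OF that] by auto
  have mem: "A s \<in> sets ?V" if "s \<in> a" for s
    using A[OF that] measurable_sets[OF comp] a that by auto
  show "space M \<inter> (\<Inter>s\<in>a. A s) \<in> sets ?V"
  proof (cases "a = {}")
    case True
    then show ?thesis using sets.top[of ?V] by simp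
  next
    case False
    then have "space M \<inter> (\<Inter>s\<in>a. A s) = (\<Inter>s\<in>a. A s)" using sub by blast
    then show ?thesis using False fin mem by (auto intro: sets.finite_INT)
  qed
  show "prob (space M \<inter> (\<Inter>s\<in>a. A s)) = (\<Prod>s\<in>a. prob (A s))"
  proof (cases "a = {}")
    case True
    then show ?thesis by (simp add: prob_space)
  next
    case False
    then have "space M \<inter> (\<Inter>s\<in>a. A s) = (\<Inter>s\<in>a. A s)" using sub by blast
    moreover have "prob (\<Inter>s\<in>a. A s) = (\<Prod>s\<in>a. prob (A s))"
      using ind False fin a A
      by (intro indep_setsD[where F = "\<lambda>s. {Z s -` B \<inter> space M | B. B \<in> sets N}" and I = I])
         (auto simp: indep_vars_def2)
    ultimately show ?thesis by simp
  qed
qed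

lemma Int_stable_preimages: "Int_stable {Z -` B \<inter> \<Omega> | B. B \<in> sets N}"
proof (rule Int_stableI)
  fix a b assume "a \<in> {Z -` B \<inter> \<Omega> | B. B \<in> sets N}" "b \<in> {Z -` B \<inter> \<Omega> | B. B \<in> sets N}"
  then obtain B B' where "B \<in> sets N" "B' \<in> sets N" "a = Z -` B \<inter> \<Omega>" "b = Z -` B' \<inter> \<Omega>"
    by blast
  then have "B \<inter> B' \<in> sets N" "a \<inter> b = Z -` (B \<inter> B') \<inter> \<Omega>" by auto
  then show "a \<inter> b \<in> {Z -` B \<inter> \<Omega> | B. B \<in> sets N}" by blast
qed

section \<open>Independence of the next noise from the past\<close>

text \<open>Tags for the primitive random objects, which have three different value types; they allow one
  index set for all of them.\<close>
datatype source = Initial | Eta nat | Eps nat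

context controlled_observation_model
begin

primrec source_events :: "source \<Rightarrow> 'w set set" where
  "source_events Initial = {X 0 -` B \<inter> space M | B. B \<in> sets MX}"
| "source_events (Eta s) = {\<eta> s -` B \<inter> space M | B. B \<in> sets ME}"
| "source_events (Eps s) = {\<epsilon> s -` B \<inter> space M | B. B \<in> sets MV}"

declare source_events.simps [simp del]

lemma source_events_subset: "source_events i \<subseteq> Pow (space M)"
  by (cases i) (auto simp: source_events.simps)

lemma eta_measurable: "1 \<le> s \<Longrightarrow> \<eta> s \<in> measurable M ME"
  using eta_indep by (auto simp: indep_vars_def)

lemma eps_measurable: "1 \<le> s \<Longrightarrow> \<epsilon> s \<in> measurable M MV"
  using eps_indep by (auto simp: indep_vars_def)

lemma Int_stable_source_events: "Int_stable (source_events i)"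
  by (cases i) (simp_all only: source_events.simps Int_stable_preimages)

definition sources :: "source set" where
  "sources = insert Initial (Eta ` {1..} \<union> Eps ` {1..})"

text \<open>A finite intersection splits into its initial part and its two noise parts. Mutual independence
  factorises the three parts, independence within each sequence factorises the noise parts.\<close>
lemma source_events_indep: "indep_sets source_events sources"
proof (rule indep_setsI)
  fix i assume "i \<in> sources"
  then show "source_events i \<subseteq> events"
    using initial_measurable eta_measurable eps_measurable
    by (auto simp: sources_def source_events.simps)
next
  fix A K assume K: "K \<noteq> {}" "K \<subseteq> sources" "finite K" and A: "\<forall>i\<in>K. A i \<in> source_events i"
  define a b where "a = Eta -` K" and "b = Eps -` K"
  have ab: "finite a" "finite b" "a \<subseteq> {1..}" "b \<subseteq> {1..}"
    using K(2,3) by (auto simp: a_def b_def sources_def inj_on_def intro: finite_vimageI)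
  have K_eq: "K = (K \<inter> {Initial}) \<union> (Eta ` a \<union> Eps ` b)"
    using K(2) by (auto simp: a_def b_def sources_def)
  let ?E0 = "if Initial \<in> K then A Initial else space M"
  let ?E1 = "space M \<inter> (\<Inter>s\<in>a. A (Eta s))"
  let ?E2 = "space M \<inter> (\<Inter>s\<in>b. A (Eps s))"
  have Aa: "A (Eta s) \<in> {\<eta> s -` B \<inter> space M | B. B \<in> sets ME}" if "s \<in> a" for s
    using A that by (auto simp: a_def source_events.simps)
  have Ab: "A (Eps s) \<in> {\<epsilon> s -` B \<inter> space M | B. B \<in> sets MV}" if "s \<in> b" for s
    using A that by (auto simp: b_def source_events.simps)
  note E1 = indep_vars_finite_Int[OF eta_indep ab(1,3) Aa]
  note E2 = indep_vars_finite_Int[OF eps_indep ab(2,4) Ab]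
  have E0: "?E0 \<in> sets (vimage_algebra (space M) (X 0) MX)"
  proof -
    have m: "X 0 \<in> measurable (vimage_algebra (space M) (X 0) MX) MX"
      using initial_measurable by (intro measurable_vimage_algebra1) (auto simp: measurable_def)
    have "A Initial \<in> {X 0 -` B \<inter> space M | B. B \<in> sets MX}" if "Initial \<in> K"
      using A that by (auto simp: source_events.simps)
    then show ?thesis
      using measurable_sets[OF m] sets.top[of "vimage_algebra (space M) (X 0) MX"] by auto
  qed
  have lt3: "{..<3::nat} = {0, 1, 2}" by auto
  have "prob (?E0 \<inter> (?E1 \<inter> ?E2)) = prob (\<Inter>i\<in>{..<3::nat}. [?E0, ?E1, ?E2] ! i)"
    by (simp add: lt3)
  also have "\<dots> = (\<Prod>i\<in>{..<3::nat}. prob ([?E0, ?E1, ?E2] ! i))"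
    using E0 E1(1) E2(1) by (intro indep_setsD[OF mutual_indep]) (auto simp: lt3)
  also have "\<dots> = prob ?E0 * ((\<Prod>s\<in>a. prob (A (Eta s))) * (\<Prod>s\<in>b. prob (A (Eps s))))"
    by (simp add: lt3 E1(2) E2(2) del: Int_iff)
  also have "\<dots> = (\<Prod>i\<in>K. prob (A i))"
  proof -
    have "(\<Prod>i\<in>K. prob (A i)) = (\<Prod>i\<in>(K \<inter> {Initial}) \<union> (Eta ` a \<union> Eps ` b). prob (A i))"
      using K_eq by simp
    also have "\<dots> = (\<Prod>i\<in>K \<inter> {Initial}. prob (A i)) *
        ((\<Prod>i\<in>Eta ` a. prob (A i)) * (\<Prod>i\<in>Eps ` b. prob (A i)))"
      using ab by (subst prod.union_disjoint; (subst prod.union_disjoint)?) auto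
    also have "\<dots> = prob ?E0 * ((\<Prod>s\<in>a. prob (A (Eta s))) * (\<Prod>s\<in>b. prob (A (Eps s))))"
      by (simp add: prod.reindex inj_on_def prob_space)
    finally show ?thesis by simp
  qed
  also have "?E0 \<inter> (?E1 \<inter> ?E2) = (\<Inter>i\<in>K. A i)"
  proof -
    obtain i where "i \<in> K" using K(1) by blast
    then have sub: "(\<Inter>i\<in>K. A i) \<subseteq> space M" using A source_events_subset by blast
    show ?thesis
    proof (rule set_eqI)
      fix x
      have "(\<forall>i. i \<in> K \<longrightarrow> x \<in> A i) \<longleftrightarrow> (Initial \<in> K \<longrightarrow> x \<in> A Initial) \<and>
          (\<forall>s. Eta s \<in> K \<longrightarrow> x \<in> A (Eta s)) \<and> (\<forall>s. Eps s \<in> K \<longrightarrow> x \<in> A (Eps s))"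
        by (metis source.exhaust)
      then have "x \<in> (\<Inter>i\<in>K. A i) \<longleftrightarrow> x \<in> space M \<and> (Initial \<in> K \<longrightarrow> x \<in> A Initial) \<and>
          (\<forall>s. s \<in> a \<longrightarrow> x \<in> A (Eta s)) \<and> (\<forall>s. s \<in> b \<longrightarrow> x \<in> A (Eps s))"
        using sub by (auto simp: a_def b_def)
      also have "\<dots> \<longleftrightarrow> x \<in> ?E0 \<inter> (?E1 \<inter> ?E2)"
        by (cases "Initial \<in> K") auto
      finally show "x \<in> ?E0 \<inter> (?E1 \<inter> ?E2) \<longleftrightarrow> x \<in> (\<Inter>i\<in>K. A i)" by blast
    qed
  qed
  finally show "prob (\<Inter>i\<in>K. A i) = (\<Prod>i\<in>K. prob (A i))" .
qed

definition past_sources :: "nat \<Rightarrow> source set" where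
  "past_sources t = insert Initial (Eta ` {1..t} \<union> Eps ` {1..t})"

definition past :: "nat \<Rightarrow> 'w measure" where
  "past t = sigma (space M) (\<Union>i\<in>past_sources t. source_events i)"

lemma space_past [simp]: "space (past t) = space M"
  by (simp add: past_def space_measure_of_conv)

lemma sets_past: "sets (past t) = sigma_sets (space M) (\<Union>i\<in>past_sources t. source_events i)"
  unfolding past_def using source_events_subset by (intro sets_measure_of) blast

lemma source_events_in_past: "i \<in> past_sources t \<Longrightarrow> source_events i \<subseteq> sets (past t)"
  by (auto simp: sets_past intro: sigma_sets.Basic)

lemma past_mono: "s \<le> t \<Longrightarrow> sets (past s) \<subseteq> sets (past t)"
  unfolding sets_past by (intro sigma_sets_mono') (force simp: past_sources_def)

lemma past_events: "sets (past t) \<subseteq> events"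
  unfolding sets_past
proof (rule sets.sigma_sets_subset)
  have "past_sources t \<subseteq> sources" by (auto simp: past_sources_def sources_def)
  then show "(\<Union>i\<in>past_sources t. source_events i) \<subseteq> events"
    using source_events_indep by (fastforce simp: indep_sets_def)
qed

lemma measurable_past_preimages:
  assumes "i \<in> past_sources t" "source_events i = {Z -` B \<inter> space M | B. B \<in> sets N}"
    "Z \<in> space M \<rightarrow> space N"
  shows "Z \<in> measurable (past t) N"
  using source_events_in_past[OF assms(1)] assms(2,3) by (auto simp: measurable_def)

text \<open>The identity map serves as the random variable that carries the whole \<open>\<sigma>\<close>-algebra of the past,
  so that integrands may depend on the past in an arbitrary measurable way.\<close>
lemma past_next_noise_indep:
  "distr M (past t \<Otimes>\<^sub>M (ME \<Otimes>\<^sub>M MV)) (\<lambda>\<omega>. (\<omega>, \<eta> (Suc t) \<omega>, \<epsilon> (Suc t) \<omega>)) =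
    distr M (past t) (\<lambda>\<omega>. \<omega>) \<Otimes>\<^sub>M distr M (ME \<Otimes>\<^sub>M MV) (\<lambda>\<omega>. (\<eta> (Suc t) \<omega>, \<epsilon> (Suc t) \<omega>))"
proof (rule distr_Pair_eq_pair_measure)
  let ?I = "case_bool (past_sources t) {Eta (Suc t), Eps (Suc t)}"
  have "indep_sets (\<lambda>j. sigma_sets (space M) (\<Union>i\<in>?I j. source_events i)) UNIV"
  proof (rule indep_sets_collect_sigma)
    show "indep_sets source_events (\<Union>j\<in>UNIV. ?I j)"
      by (rule indep_sets_mono_index[OF _ source_events_indep])
         (auto simp: past_sources_def sources_def UNIV_bool)
    show "disjoint_family_on ?I UNIV"
      by (auto simp: disjoint_family_on_def past_sources_def split: bool.split)
  qed (rule Int_stable_source_events)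
  also have "(\<lambda>j. sigma_sets (space M) (\<Union>i\<in>?I j. source_events i)) =
      case_bool (sigma_sets (space M) (\<Union>i\<in>past_sources t. source_events i))
        (sigma_sets (space M) (source_events (Eta (Suc t)) \<union> source_events (Eps (Suc t))))"
    by (rule ext) (simp split: bool.split)
  finally show "indep_set (sigma_sets (space M) (\<Union>i\<in>past_sources t. source_events i))
        (sigma_sets (space M) (source_events (Eta (Suc t)) \<union> source_events (Eps (Suc t))))"
    by (simp add: indep_set_def)
  show "(\<lambda>\<omega>. \<omega>) \<in> measurable (sigma (space M) (\<Union>i\<in>past_sources t. source_events i)) (past t)"
    by (simp add: past_def)
  let ?N = "sigma (space M) (source_events (Eta (Suc t)) \<union> source_events (Eps (Suc t)))"
  have "source_events (Eta (Suc t)) \<union> source_events (Eps (Suc t)) \<subseteq> sets ?N"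
    using source_events_subset by auto
  then have "\<eta> (Suc t) \<in> measurable ?N ME" "\<epsilon> (Suc t) \<in> measurable ?N MV"
    using eta_measurable[of "Suc t"] eps_measurable[of "Suc t"]
    by (auto simp: measurable_def source_events.simps space_measure_of_conv)
  then show "(\<lambda>\<omega>. (\<eta> (Suc t) \<omega>, \<epsilon> (Suc t) \<omega>)) \<in> measurable ?N (ME \<Otimes>\<^sub>M MV)"
    by measurable
qed

lemma next_noises_indep:
  "distr M (ME \<Otimes>\<^sub>M MV) (\<lambda>\<omega>. (\<eta> (Suc t) \<omega>, \<epsilon> (Suc t) \<omega>)) =
    distr M ME (\<eta> (Suc t)) \<Otimes>\<^sub>M distr M MV (\<epsilon> (Suc t))"
proof (rule distr_Pair_eq_pair_measure)
  let ?I = "case_bool {Eta (Suc t)} {Eps (Suc t)}"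
  have "indep_sets (\<lambda>j. sigma_sets (space M) (\<Union>i\<in>?I j. source_events i)) UNIV"
  proof (rule indep_sets_collect_sigma)
    show "indep_sets source_events (\<Union>j\<in>UNIV. ?I j)"
      by (rule indep_sets_mono_index[OF _ source_events_indep])
         (auto simp: sources_def UNIV_bool)
    show "disjoint_family_on ?I UNIV"
      by (auto simp: disjoint_family_on_def split: bool.split)
  qed (rule Int_stable_source_events)
  also have "(\<lambda>j. sigma_sets (space M) (\<Union>i\<in>?I j. source_events i)) =
      case_bool (sigma_sets (space M) (source_events (Eta (Suc t))))
        (sigma_sets (space M) (source_events (Eps (Suc t))))"
    by (rule ext) (simp split: bool.split)
  finally show "indep_set (sigma_sets (space M) (source_events (Eta (Suc t))))
        (sigma_sets (space M) (source_events (Eps (Suc t))))"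
    by (simp add: indep_set_def)
  have "source_events i \<subseteq> sets (sigma (space M) (source_events i))" for i
    using source_events_subset by auto
  then show "\<eta> (Suc t) \<in> measurable (sigma (space M) (source_events (Eta (Suc t)))) ME"
     "\<epsilon> (Suc t) \<in> measurable (sigma (space M) (source_events (Eps (Suc t)))) MV"
    using eta_measurable[of "Suc t"] eps_measurable[of "Suc t"]
    by (fastforce simp: measurable_def source_events.simps space_measure_of_conv)+
qed

text \<open>Tonelli's theorem for the product law of the past and the two next noises.\<close>
lemma nn_integral_past_noise:
  assumes g[measurable]: "g \<in> borel_measurable (past t \<Otimes>\<^sub>M (ME \<Otimes>\<^sub>M MV))"
  shows "(\<integral>\<^sup>+\<omega>. g (\<omega>, \<eta> (Suc t) \<omega>, \<epsilon> (Suc t) \<omega>) \<partial>M) =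
    (\<integral>\<^sup>+\<omega>. (\<integral>\<^sup>+e. (\<integral>\<^sup>+v. g (\<omega>, e, v) \<partial>\<nu>\<epsilon>) \<partial>\<nu>\<eta>) \<partial>M)"
proof -
  have [measurable]: "\<eta> (Suc t) \<in> measurable M ME" "\<epsilon> (Suc t) \<in> measurable M MV"
    by (simp_all add: eta_measurable eps_measurable)
  have id[measurable]: "(\<lambda>\<omega>. \<omega>) \<in> measurable M (past t)"
    using past_events[of t] by (auto simp: measurable_def)
  have laws: "sets \<nu>\<eta> = sets ME" "prob_space \<nu>\<eta>" "sets \<nu>\<epsilon> = sets MV" "prob_space \<nu>\<epsilon>"
    using law_eta law_eps by (auto simp: space_prob_algebra)
  interpret eps: prob_space \<nu>\<epsilon> by fact
  interpret noise: prob_space "\<nu>\<eta> \<Otimes>\<^sub>M \<nu>\<epsilon>" using laws by (intro prob_space_pair) 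
  have sets_noise[measurable_cong]: "sets (\<nu>\<eta> \<Otimes>\<^sub>M \<nu>\<epsilon>) = sets (ME \<Otimes>\<^sub>M MV)"
    by (intro sets_pair_measure_cong laws)
  note laws(1,3)[measurable_cong]
  have noise: "distr M (ME \<Otimes>\<^sub>M MV) (\<lambda>\<omega>. (\<eta> (Suc t) \<omega>, \<epsilon> (Suc t) \<omega>)) = \<nu>\<eta> \<Otimes>\<^sub>M \<nu>\<epsilon>"
    using next_noises_indep[of t] eta_law[of "Suc t"] eps_law[of "Suc t"]
    by simp
  let ?P = "distr M (past t) (\<lambda>\<omega>. \<omega>)"
  have joint: "distr M (past t \<Otimes>\<^sub>M (ME \<Otimes>\<^sub>M MV)) (\<lambda>\<omega>. (\<omega>, \<eta> (Suc t) \<omega>, \<epsilon> (Suc t) \<omega>)) =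
      ?P \<Otimes>\<^sub>M (\<nu>\<eta> \<Otimes>\<^sub>M \<nu>\<epsilon>)"
    using past_next_noise_indep[of t] by (simp add: noise)
  have "(\<integral>\<^sup>+\<omega>. g (\<omega>, \<eta> (Suc t) \<omega>, \<epsilon> (Suc t) \<omega>) \<partial>M) = (\<integral>\<^sup>+z. g z \<partial>(?P \<Otimes>\<^sub>M (\<nu>\<eta> \<Otimes>\<^sub>M \<nu>\<epsilon>)))"
    unfolding joint[symmetric] by (subst nn_integral_distr) measurable
  also have "\<dots> = (\<integral>\<^sup>+\<omega>. (\<integral>\<^sup>+y. g (\<omega>, y) \<partial>(\<nu>\<eta> \<Otimes>\<^sub>M \<nu>\<epsilon>)) \<partial>?P)"
    by (subst noise.nn_integral_fst[symmetric]) measurable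
  also have "\<dots> = (\<integral>\<^sup>+\<omega>. (\<integral>\<^sup>+y. g (\<omega>, y) \<partial>(\<nu>\<eta> \<Otimes>\<^sub>M \<nu>\<epsilon>)) \<partial>M)"
    by (subst nn_integral_distr) measurable
  also have "\<dots> = (\<integral>\<^sup>+\<omega>. (\<integral>\<^sup>+e. (\<integral>\<^sup>+v. g (\<omega>, e, v) \<partial>\<nu>\<epsilon>) \<partial>\<nu>\<eta>) \<partial>M)"
  proof (rule nn_integral_cong)
    fix \<omega> assume "\<omega> \<in> space M"
    then have [measurable]: "\<omega> \<in> space (past t)" by simp
    show "(\<integral>\<^sup>+y. g (\<omega>, y) \<partial>(\<nu>\<eta> \<Otimes>\<^sub>M \<nu>\<epsilon>)) = (\<integral>\<^sup>+e. (\<integral>\<^sup>+v. g (\<omega>, e, v) \<partial>\<nu>\<epsilon>) \<partial>\<nu>\<eta>)"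
      by (subst eps.nn_integral_fst[symmetric]) measurable
  qed
  finally show ?thesis .
qed

section \<open>Observations, controls and information\<close>

abbreviation "cell \<equiv> obs_class MX A J r"
abbreviation "cells \<equiv> class_indices MX A J r"
abbreviation "info \<equiv> information M MU Y U"
abbreviation "predicted u \<mu> C \<equiv> predicted_law \<nu>\<eta> \<nu>\<epsilon> G u \<mu> C"

lemma finite_cells: "finite cells"
  by (simp add: class_indices_def)

lemma cell_measurable: "i \<in> cells \<Longrightarrow> cell i \<in> sets MX"
proof -
  have un: "(\<Union>l\<in>J i. A l) \<in> sets MX" if "i \<in> {1..r}" for i
  proof (rule sets.finite_UN)
    show "finite (J i)" using J_subset[OF that] by (rule finite_subset) simp
    show "A l \<in> sets MX" if "l \<in> J i" for l
      using J_subset[OF \<open>i \<in> {1..r}\<close>] that by (intro partition_measurable) blast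
  qed
  assume "i \<in> cells"
  then have "i \<in> {1..r} \<or> i = r + 1"
    by (auto simp: class_indices_def split: if_splits)
  then show ?thesis
  proof
    assume "i = r + 1"
    moreover have "(\<Union>l\<in>{1..r}. \<Union>i\<in>J l. A i) \<in> sets MX"
      by (intro sets.finite_UN un) auto
    ultimately show ?thesis by (simp add: obs_class_def)
  next
    assume "i \<in> {1..r}"
    then show ?thesis using un[of i] by (simp add: obs_class_def)
  qed
qed

text \<open>The observation takes finitely many values and each of its level sets is a preimage of a class
  under the state, so it is measurable for whatever \<open>\<sigma>\<close>-algebra the state is measurable for.\<close>
lemma preimage_Y:
  assumes "X s \<in> measurable N MX" "space N = space M"
  shows "Y s -` B \<inter> space M \<in> sets N"
proof -
  have cell_iff: "X s \<omega> \<in> cell i \<longleftrightarrow> Y s \<omega> = i" if "\<omega> \<in> space M" "i \<in> cells" for \<omega> i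
    using Y_iff[OF that, of s] by simp
  have "Y s -` B \<inter> space M = (\<Union>i\<in>B \<inter> cells. X s -` cell i \<inter> space N)"
  proof (rule set_eqI)
    fix \<omega>
    have "\<omega> \<in> (\<Union>i\<in>B \<inter> cells. X s -` cell i \<inter> space N) \<longleftrightarrow>
        \<omega> \<in> space M \<and> (\<exists>i\<in>cells. i \<in> B \<and> Y s \<omega> = i)"
      using cell_iff assms(2) by fastforce
    also have "\<dots> \<longleftrightarrow> \<omega> \<in> Y s -` B \<inter> space M"
      using Y_in[of \<omega> s] by auto
    finally show "\<omega> \<in> Y s -` B \<inter> space M \<longleftrightarrow> \<omega> \<in> (\<Union>i\<in>B \<inter> cells. X s -` cell i \<inter> space N)"
      by blast
  qed
  also have "\<dots> \<in> sets N"
    using finite_cells measurable_sets[OF assms(1) cell_measurable] by (intro sets.finite_UN) auto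
  finally show ?thesis .
qed

lemma space_info [simp]: "space (info t) = space M"
  by (simp add: information_def space_measure_of_conv)

lemma sets_info: "sets (info t) = sigma_sets (space M)
    ({Y s -` B \<inter> space M | s B. s \<le> t} \<union> {U s -` B \<inter> space M | s B. s < t \<and> B \<in> sets MU})"
  unfolding information_def by (intro sets_measure_of Un_least) blast+

lemma info_mono:
  assumes "s \<le> t"
  shows "sets (info s) \<subseteq> sets (info t)"
  unfolding sets_info
proof (rule sigma_sets_mono', rule Un_mono; rule Collect_mono; intro impI; elim exE conjE)
  fix a s' and B :: "nat set"
  assume "a = Y s' -` B \<inter> space M" "s' \<le> s"
  then show "\<exists>s B. a = Y s -` B \<inter> space M \<and> s \<le> t"
    using assms by (intro exI[of _ s'] exI[of _ B]) simp
next
  fix a s' B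
  assume "a = U s' -` B \<inter> space M" "s' < s" "B \<in> sets MU"
  then show "\<exists>s B. a = U s -` B \<inter> space M \<and> s < t \<and> B \<in> sets MU"
    using assms by (intro exI[of _ s'] exI[of _ B]) simp
qed

lemma measurable_past_mono:
  "f \<in> measurable (past s) L \<Longrightarrow> s \<le> t \<Longrightarrow> f \<in> measurable (past t) L"
  by (rule measurable_from_subalg[of _ "past s"]) (simp_all add: subalgebra_def past_mono)

text \<open>Both claims have to be proved together because of feedback: the state at time \<open>t\<close> uses the
  control of time \<open>t - 1\<close>, which is a function of the information, which in turn is generated by
  earlier states and controls.\<close>
lemma X_measurable_past_and_info_le_past: "X t \<in> measurable (past t) MX \<and> sets (info t) \<subseteq> sets (past t)"
proof (induction t rule: less_induct)
  case (less t)
  have U_past: "U s \<in> measurable (past t) MU" if "s < t" for s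
  proof (rule measurable_from_subalg[OF _ control_adapted])
    have "sets (info s) \<subseteq> sets (past t)"
      using less[OF that] past_mono[of s t] that by (meson less_imp_le subset_trans)
    then show "subalgebra (past t) (info s)" by (simp add: subalgebra_def)
  qed
  have X_t: "X t \<in> measurable (past t) MX"
  proof (cases t)
    case 0
    have "X 0 \<in> measurable (past t) MX"
    proof (rule measurable_past_preimages)
      show "Initial \<in> past_sources t" by (simp add: past_sources_def)
      show "X 0 \<in> space M \<rightarrow> space MX" using measurable_space[OF initial_measurable] by blast
    qed (rule source_events.simps)
    then show ?thesis using 0 by simp
  next
    case (Suc s)
    have [measurable]: "X s \<in> measurable (past t) MX"
    proof (rule measurable_past_mono)
      show "X s \<in> measurable (past s) MX" using less.IH[of s] Suc by blast
    qed (simp add: Suc)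
    have [measurable]: "U s \<in> measurable (past t) MU" using U_past Suc by simp
    have [measurable]: "\<eta> t \<in> measurable (past t) ME"
    proof (rule measurable_past_preimages)
      show "Eta t \<in> past_sources t" using Suc by (simp add: past_sources_def)
      show "\<eta> t \<in> space M \<rightarrow> space ME" using measurable_space[OF eta_measurable[of t]] Suc by auto
    qed (rule source_events.simps)
    have [measurable]: "\<epsilon> t \<in> measurable (past t) MV"
    proof (rule measurable_past_preimages)
      show "Eps t \<in> past_sources t" using Suc by (simp add: past_sources_def)
      show "\<epsilon> t \<in> space M \<rightarrow> space MV" using measurable_space[OF eps_measurable[of t]] Suc by auto
    qed (rule source_events.simps)
    note G_measurable[measurable]
    have "(\<lambda>\<omega>. G (X s \<omega>, U s \<omega>, \<eta> t \<omega>, \<epsilon> t \<omega>)) \<in> measurable (past t) MX"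
      by measurable
    then show ?thesis
      using dynamics[of _ s] Suc by (subst measurable_cong) auto
  qed
  have X_past: "X s \<in> measurable (past t) MX" if "s \<le> t" for s
  proof (cases "s = t")
    case False
    with that have "s < t" by simp
    with less.IH have "X s \<in> measurable (past s) MX" by blast
    then show ?thesis using that by (rule measurable_past_mono)
  qed (use X_t in simp)
  have "sets (info t) \<subseteq> sets (past t)"
    unfolding sets_info space_past[of t, symmetric]
  proof (rule sets.sigma_sets_subset, safe)
    show "Y s -` B \<inter> space (past t) \<in> sets (past t)" if "s \<le> t" for s B
      using preimage_Y[OF X_past[OF that]] by simp
    show "U s -` B \<inter> space (past t) \<in> sets (past t)" if "s < t" "B \<in> sets MU" for s B
      using measurable_sets[OF U_past that(2)] that by simp
  qed
  with X_t show ?case by simp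
qed

lemmas X_past = X_measurable_past_and_info_le_past[THEN conjunct1]
lemmas info_le_past = X_measurable_past_and_info_le_past[THEN conjunct2]

lemma X_rv [measurable]: "X t \<in> measurable M MX"
  by (rule measurable_from_subalg[OF _ X_past[of t]]) (simp add: subalgebra_def past_events)

lemma info_events: "sets (info t) \<subseteq> events"
  using info_le_past past_events by blast

lemma info_subalgebra: "subalgebra M (info t)"
  using info_events by (simp add: subalgebra_def)

text \<open>On the event that the new observation is \<open>j\<close>, the new information is the old one: the events
  with an old trace form a \<open>\<sigma>\<close>-algebra; it contains the generators of time at most \<open>t\<close>, the control
  \<open>U t\<close> being measurable for the information at time \<open>t\<close>, and an event of the new observation
  is there either full or empty.\<close>
lemma info_next_on_observation:
  assumes "F \<in> sets (info (Suc t))"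
  obtains F' where "F' \<in> sets (info t)"
    "F \<inter> {\<omega>\<in>space M. Y (Suc t) \<omega> = j} = F' \<inter> {\<omega>\<in>space M. Y (Suc t) \<omega> = j}"
proof -
  let ?D = "{\<omega>\<in>space M. Y (Suc t) \<omega> = j}"
  have "\<exists>F'\<in>sets (info t). F \<inter> ?D = F' \<inter> ?D"
    using assms unfolding sets_info[of "Suc t"]
  proof (induction rule: sigma_sets.induct)
    case (Basic a)
    then consider s B where "s \<le> t" "a = Y s -` B \<inter> space M"
      | B where "a = Y (Suc t) -` B \<inter> space M"
      | s B where "s \<le> t" "B \<in> sets MU" "a = U s -` B \<inter> space M"
      by (auto simp: le_Suc_eq less_Suc_eq_le)
    then show ?case
    proof cases
      case 1
      then have "a \<in> sets (info t)" unfolding sets_info by (intro sigma_sets.Basic) blast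
      then show ?thesis by blast
    next
      case 2
      show ?thesis
      proof (cases "j \<in> B")
        case True
        then have "a \<inter> ?D = space M \<inter> ?D" using 2 by auto
        then show ?thesis using sets.top[of "info t"] by auto
      next
        case False
        then have "a \<inter> ?D = {} \<inter> ?D" using 2 by auto
        then show ?thesis by blast
      qed
    next
      case 3
      then have "a \<in> sets (info t)"
        using measurable_sets[OF control_adapted[of s] 3(2)] info_mono[of s t] by auto
      then show ?thesis by blast
    qed
  next
    case Empty
    then show ?case by blast
  next
    case (Compl a)
    then obtain F' where "F' \<in> sets (info t)" "a \<inter> ?D = F' \<inter> ?D" by blast
    then have "space M - F' \<in> sets (info t)" "(space M - a) \<inter> ?D = (space M - F') \<inter> ?D"
      using sets.compl_sets[of F' "info t"] by auto
    then show ?case by blast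
  next
    case (Union a)
    then obtain F' where "\<And>i. F' i \<in> sets (info t)" "\<And>i. a i \<inter> ?D = F' i \<inter> ?D" by metis
    then have "(\<Union>i::nat. F' i) \<in> sets (info t)" "(\<Union>i. a i) \<inter> ?D = (\<Union>i. F' i) \<inter> ?D" by auto
    then show ?case by blast
  qed
  then show ?thesis using that by blast
qed

section \<open>The filter as a conditional distribution\<close>

lemma filter_laws:
  assumes "\<omega> \<in> space M"
  shows "prob_space (\<pi> t \<omega>)" "sets (\<pi> t \<omega>) = sets MX" "\<pi> t \<omega> \<in> space (prob_algebra MX)"
  using measurable_space[OF filter_kernel[of t], of \<omega>] assms by (simp_all add: space_prob_algebra)

lemma filter_subprob_kernel: "\<pi> t \<in> measurable (info t) (subprob_algebra MX)"
  by (rule measurable_prob_algebraD[OF filter_kernel])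

text \<open>The defining property of the filter, freed from the real-valued conditional expectation so that
  it can be used with nonnegative integrals.\<close>
lemma filter_emeasure:
  assumes F: "F \<in> sets (info t)" and C: "C \<in> sets MX"
  shows "(\<integral>\<^sup>+\<omega>\<in>F. emeasure (\<pi> t \<omega>) C \<partial>M) = emeasure M (F \<inter> (X t -` C \<inter> space M))"
proof -
  interpret finite_measure_subalgebra M "info t"
    by unfold_locales (rule info_subalgebra)
  have [measurable]: "F \<in> sets M" using F info_events by blast
  note C[measurable]
  have [measurable]: "(\<lambda>\<omega>. measure (\<pi> t \<omega>) C) \<in> borel_measurable M"
    using measurable_compose[OF filter_kernel measurable_measure_prob_algebra[OF C]]
    by (rule measurable_from_subalg[OF info_subalgebra])
  have le1: "measure (\<pi> t \<omega>) C \<le> 1" if "\<omega> \<in> space M" for \<omega>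
    using filter_laws(1)[OF that] by (rule prob_space.prob_le_1)
  have int: "integrable M (\<lambda>\<omega>. indicator F \<omega> * measure (\<pi> t \<omega>) C)"
    using le1 by (intro integrable_const_bound[where B = 1]) (auto intro!: AE_I2 simp: indicator_def)
  have "(\<integral>\<omega>\<in>F. indicator C (X t \<omega>) \<partial>M) =
      (\<integral>\<omega>\<in>F. real_cond_exp M (info t) (\<lambda>\<omega>. indicator C (X t \<omega>)) \<omega> \<partial>M)"
    using F by (intro real_cond_exp_intA integrable_const_bound[where B = 1])
      (auto intro!: AE_I2 simp: indicator_def)
  also have "\<dots> = (\<integral>\<omega>\<in>F. measure (\<pi> t \<omega>) C \<partial>M)"
    using filter_cond_prob[OF C, of t] by (intro set_lebesgue_integral_cong_AE) auto
  finally have eq: "(\<integral>\<omega>. indicator F \<omega> * measure (\<pi> t \<omega>) C \<partial>M) =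
      (\<integral>\<omega>. indicator F \<omega> * indicator C (X t \<omega>) \<partial>M)"
    by (simp add: set_lebesgue_integral_def)
  have "(\<integral>\<^sup>+\<omega>\<in>F. emeasure (\<pi> t \<omega>) C \<partial>M) =
      (\<integral>\<^sup>+\<omega>. ennreal (indicator F \<omega> * measure (\<pi> t \<omega>) C) \<partial>M)"
  proof (rule nn_integral_cong)
    fix \<omega> assume "\<omega> \<in> space M"
    then interpret p: prob_space "\<pi> t \<omega>" by (rule filter_laws)
    show "emeasure (\<pi> t \<omega>) C * indicator F \<omega> = ennreal (indicator F \<omega> * measure (\<pi> t \<omega>) C)"
      by (simp add: p.emeasure_eq_measure indicator_def)
  qed
  also have "\<dots> = ennreal (\<integral>\<omega>. indicator F \<omega> * measure (\<pi> t \<omega>) C \<partial>M)"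
    by (rule nn_integral_eq_integral[OF int]) simp
  also have "\<dots> = ennreal (\<integral>\<omega>. indicator (F \<inter> (X t -` C \<inter> space M)) \<omega> \<partial>M)"
    unfolding eq by (intro arg_cong[where f = ennreal] Bochner_Integration.integral_cong)
      (auto simp: indicator_def)
  also have "\<dots> = emeasure M (F \<inter> (X t -` C \<inter> space M))"
    using sets.sets_into_space[OF \<open>F \<in> sets M\<close>] by (simp add: emeasure_eq_measure Int_absorb2 le_infI1)
  finally show ?thesis .
qed

text \<open>The joint law of information and state is the semidirect product of the information with the
  filter, because the two measures agree on rectangles by \<open>filter_emeasure\<close>.\<close>
lemma filter_disintegration:
  assumes g[measurable]: "g \<in> borel_measurable (info t \<Otimes>\<^sub>M MX)"
  shows "(\<integral>\<^sup>+\<omega>. g (\<omega>, X t \<omega>) \<partial>M) = (\<integral>\<^sup>+\<omega>. (\<integral>\<^sup>+x. g (\<omega>, x) \<partial>\<pi> t \<omega>) \<partial>M)"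
proof -
  let ?H = "info t"
  let ?R = "restr_to_subalg M ?H"
  \<comment> \<open>The filter is attached to the sample point that determines it, so that binding \<open>?K\<close>
      gives a law of pairs.\<close>
  let ?K = "\<lambda>\<omega>. distr (\<pi> t \<omega>) (?H \<Otimes>\<^sub>M MX) (Pair \<omega>)"
  let ?J = "distr M (?H \<Otimes>\<^sub>M MX) (\<lambda>\<omega>. (\<omega>, X t \<omega>))"
  note sub = info_subalgebra[of t]
  have id: "(\<lambda>\<omega>. \<omega>) \<in> measurable M ?H"
    by (rule measurable_from_subalg[OF sub]) simp
  have joint: "(\<lambda>\<omega>. (\<omega>, X t \<omega>)) \<in> measurable M (?H \<Otimes>\<^sub>M MX)"
    by (intro measurable_Pair id X_rv)
  have R_H[measurable_cong]: "sets ?R = sets ?H" by (rule sets_restr_to_subalg[OF sub])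
  have space_R: "space ?R = space M" by (rule space_restr_to_subalg)
  note filter_subprob_kernel[of t, measurable]
  have K: "?K \<in> measurable ?R (subprob_algebra (?H \<Otimes>\<^sub>M MX))"
    by (rule measurable_distr2[where M = MX]) measurable
  have K_eq: "(\<integral>\<^sup>+y. f y \<partial>?K \<omega>) = (\<integral>\<^sup>+x. f (\<omega>, x) \<partial>\<pi> t \<omega>)"
    if "\<omega> \<in> space M" and [measurable]: "f \<in> borel_measurable (?H \<Otimes>\<^sub>M MX)" for \<omega> f
  proof -
    have "Pair \<omega> \<in> measurable MX (?H \<Otimes>\<^sub>M MX)"
      using that(1) by (intro measurable_Pair1') simp
    then have "Pair \<omega> \<in> measurable (\<pi> t \<omega>) (?H \<Otimes>\<^sub>M MX)"
      using measurable_cong_sets[OF filter_laws(2)[OF that(1)] refl] by blast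
    then show ?thesis by (rule nn_integral_distr) (simp add: that(2))
  qed
  have "?R \<bind> ?K = ?J"
  proof (rule measure_eqI_generator_eq[where E = "{a \<times> b | a b. a \<in> sets ?H \<and> b \<in> sets MX}"
        and \<Omega> = "space ?H \<times> space MX" and A = "\<lambda>_. space ?H \<times> space MX"])
    show "Int_stable {a \<times> b | a b. a \<in> sets ?H \<and> b \<in> sets MX}"
      by (rule Int_stable_pair_measure_generator)
    show "{a \<times> b | a b. a \<in> sets ?H \<and> b \<in> sets MX} \<subseteq> Pow (space ?H \<times> space MX)"
      by (rule pair_measure_closed)
    have "sets (?R \<bind> ?K) = sets (?H \<Otimes>\<^sub>M MX)"
      using K not_empty by (intro sets_bind) (auto simp: space_R)
    then show "sets (?R \<bind> ?K) =
        sigma_sets (space ?H \<times> space MX) {a \<times> b | a b. a \<in> sets ?H \<and> b \<in> sets MX}"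
      by (simp add: sets_pair_measure)
    show "sets ?J = sigma_sets (space ?H \<times> space MX) {a \<times> b | a b. a \<in> sets ?H \<and> b \<in> sets MX}"
      by (simp add: sets_pair_measure)
    show rect: "emeasure (?R \<bind> ?K) S = emeasure ?J S"
      if "S \<in> {a \<times> b | a b. a \<in> sets ?H \<and> b \<in> sets MX}" for S
    proof -
      obtain F C where S: "S = F \<times> C" and F: "F \<in> sets ?H" and C: "C \<in> sets MX"
        using \<open>S \<in> _\<close> by blast
      have S_sets: "S \<in> sets (?H \<Otimes>\<^sub>M MX)" using S F C by simp
      have em: "emeasure (?K \<omega>) S = emeasure (\<pi> t \<omega>) C * indicator F \<omega>" if "\<omega> \<in> space M" for \<omega>
      proof -
        have "emeasure (?K \<omega>) S = (\<integral>\<^sup>+y. indicator S y \<partial>?K \<omega>)" using S_sets by simp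
        also have "\<dots> = (\<integral>\<^sup>+x. indicator F \<omega> * indicator C x \<partial>\<pi> t \<omega>)"
          using S_sets by (subst K_eq[OF that]) (simp_all add: S indicator_times)
        also have "\<dots> = emeasure (\<pi> t \<omega>) C * indicator F \<omega>"
          using C filter_laws(2)[OF that] by (subst nn_integral_cmult_indicator) (simp_all add: mult.commute)
        finally show ?thesis .
      qed
      have "emeasure (?R \<bind> ?K) S = (\<integral>\<^sup>+\<omega>. emeasure (?K \<omega>) S \<partial>?R)"
        using K not_empty by (intro emeasure_bind[OF _ _ S_sets]) (auto simp: space_R)
      also have "\<dots> = (\<integral>\<^sup>+\<omega>. emeasure (\<pi> t \<omega>) C * indicator F \<omega> \<partial>?R)"
        by (intro nn_integral_cong em) (simp add: space_R)
      also have "\<dots> = (\<integral>\<^sup>+\<omega>. emeasure (\<pi> t \<omega>) C * indicator F \<omega> \<partial>M)"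
        using F measurable_emeasure_kernel[OF filter_subprob_kernel C]
        by (intro nn_integral_subalgebra2[OF sub]) simp
      also have "\<dots> = emeasure M (F \<inter> (X t -` C \<inter> space M))"
        by (rule filter_emeasure[OF F C])
      also have "\<dots> = emeasure ?J S"
        using S_sets by (subst emeasure_distr[OF joint]) (auto simp: S intro!: arg_cong[where f = "emeasure M"])
      finally show ?thesis .
    qed
    show "range (\<lambda>_. space ?H \<times> space MX) \<subseteq> {a \<times> b | a b. a \<in> sets ?H \<and> b \<in> sets MX}"
      by blast
    have "prob_space ?J" by (rule prob_space_distr[OF joint])
    then interpret J: prob_space ?J .
    show "emeasure (?R \<bind> ?K) (space ?H \<times> space MX) \<noteq> \<infinity>"
    proof -
      have "space ?H \<times> space MX \<in> {a \<times> b | a b. a \<in> sets ?H \<and> b \<in> sets MX}" by blast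
      from rect[OF this] show ?thesis using J.emeasure_finite by (simp only: infinity_ennreal_def) simp
    qed
  qed simp
  then have "(\<integral>\<^sup>+y. g y \<partial>?J) = (\<integral>\<^sup>+y. g y \<partial>(?R \<bind> ?K))" by simp
  also have "\<dots> = (\<integral>\<^sup>+\<omega>. (\<integral>\<^sup>+y. g y \<partial>?K \<omega>) \<partial>?R)"
    by (rule nn_integral_bind[OF g K])
  also have "\<dots> = (\<integral>\<^sup>+\<omega>. (\<integral>\<^sup>+x. g (\<omega>, x) \<partial>\<pi> t \<omega>) \<partial>?R)"
    by (intro nn_integral_cong K_eq g) (simp add: space_R)
  also have "\<dots> = (\<integral>\<^sup>+\<omega>. (\<integral>\<^sup>+x. g (\<omega>, x) \<partial>\<pi> t \<omega>) \<partial>M)"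
    by (intro nn_integral_subalgebra2[OF sub] nn_integral_measurable_subprob_algebra2[where N = MX]
        filter_subprob_kernel) (simp add: split_beta')
  finally show ?thesis by (simp add: nn_integral_distr[OF joint])
qed

section \<open>Prediction\<close>

lemma kernel_measurable:
  assumes C[measurable]: "C \<in> sets MX"
  shows "(\<lambda>(x, u). controlled_kernel \<nu>\<eta> \<nu>\<epsilon> G C x u) \<in> borel_measurable (MX \<Otimes>\<^sub>M MU)"
proof -
  have laws: "sets \<nu>\<eta> = sets ME" "prob_space \<nu>\<eta>" "sets \<nu>\<epsilon> = sets MV" "prob_space \<nu>\<epsilon>"
    using law_eta law_eps by (auto simp: space_prob_algebra)
  interpret eta: prob_space \<nu>\<eta> by fact
  interpret eps: prob_space \<nu>\<epsilon> by fact
  note laws(1,3)[measurable_cong] G_measurable[measurable]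
  show ?thesis unfolding controlled_kernel_def by measurable
qed

lemma predicted_measurable:
  assumes C: "C \<in> sets MX"
  shows "(\<lambda>\<omega>. predicted (U t \<omega>) (\<pi> t \<omega>) C) \<in> borel_measurable (info t)"
proof -
  note control_adapted[of t, measurable] kernel_measurable[OF C, measurable]
  show ?thesis
    unfolding predicted_law_def
    by (rule nn_integral_measurable_subprob_algebra2[OF _ filter_subprob_kernel]) measurable
qed

lemma kernel_le_1: "controlled_kernel \<nu>\<eta> \<nu>\<epsilon> G C x u \<le> 1"
proof -
  interpret eta: prob_space \<nu>\<eta> using law_eta by (auto simp: space_prob_algebra)
  interpret eps: prob_space \<nu>\<epsilon> using law_eps by (auto simp: space_prob_algebra)
  have "(\<integral>\<^sup>+v. indicator C (G (x, u, e, v)) \<partial>\<nu>\<epsilon>) \<le> (\<integral>\<^sup>+v. 1 \<partial>\<nu>\<epsilon>)" for e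
    by (intro nn_integral_mono) (auto simp: indicator_def)
  then have "controlled_kernel \<nu>\<eta> \<nu>\<epsilon> G C x u \<le> (\<integral>\<^sup>+e. 1 \<partial>\<nu>\<eta>)"
    unfolding controlled_kernel_def by (intro nn_integral_mono) (simp add: eps.emeasure_space_1)
  then show ?thesis by (simp add: eta.emeasure_space_1)
qed

lemma predicted_le_1: "prob_space \<mu> \<Longrightarrow> predicted u \<mu> C \<le> 1"
proof -
  assume "prob_space \<mu>"
  then interpret \<mu>: prob_space \<mu> .
  have "predicted u \<mu> C \<le> (\<integral>\<^sup>+x. 1 \<partial>\<mu>)"
    unfolding predicted_law_def by (intro nn_integral_mono kernel_le_1)
  then show ?thesis by (simp add: \<mu>.emeasure_space_1)
qed

text \<open>The predicted law is the conditional law of the next state given the information: the next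
  noises are integrated out first, with the past held fixed, which leaves the controlled
  kernel at \<open>X t\<close> and \<open>U t\<close>; then the filter integrates out the current state.\<close>
lemma prediction:
  assumes h: "h \<in> borel_measurable (info t)" and C[measurable]: "C \<in> sets MX"
  shows "(\<integral>\<^sup>+\<omega>. h \<omega> * indicator C (X (Suc t) \<omega>) \<partial>M) =
    (\<integral>\<^sup>+\<omega>. h \<omega> * predicted (U t \<omega>) (\<pi> t \<omega>) C \<partial>M)"
proof -
  have from_info: "f \<in> measurable (past t) L" if "f \<in> measurable (info t) L" for f :: "'w \<Rightarrow> 'l" and L
    using that by (intro measurable_from_subalg[of "past t" "info t"]) (simp_all add: subalgebra_def info_le_past)
  have laws: "sets \<nu>\<eta> = sets ME" "prob_space \<nu>\<eta>" "sets \<nu>\<epsilon> = sets MV" "prob_space \<nu>\<epsilon>"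
    using law_eta law_eps by (auto simp: space_prob_algebra)
  interpret eta: prob_space \<nu>\<eta> by fact
  interpret eps: prob_space \<nu>\<epsilon> by fact
  note laws(1,3)[measurable_cong] G_measurable[measurable] X_past[of t, measurable]
    from_info[OF h, measurable] from_info[OF control_adapted[of t], measurable]
  let ?g = "\<lambda>(\<omega>, e, v). h \<omega> * indicator C (G (X t \<omega>, U t \<omega>, e, v))"
  have "(\<integral>\<^sup>+\<omega>. h \<omega> * indicator C (X (Suc t) \<omega>) \<partial>M) =
      (\<integral>\<^sup>+\<omega>. ?g (\<omega>, \<eta> (Suc t) \<omega>, \<epsilon> (Suc t) \<omega>) \<partial>M)"
    by (intro nn_integral_cong) (simp add: dynamics)
  also have "\<dots> = (\<integral>\<^sup>+\<omega>. (\<integral>\<^sup>+e. (\<integral>\<^sup>+v. ?g (\<omega>, e, v) \<partial>\<nu>\<epsilon>) \<partial>\<nu>\<eta>) \<partial>M)"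
    by (rule nn_integral_past_noise) measurable
  also have "\<dots> = (\<integral>\<^sup>+\<omega>. h \<omega> * controlled_kernel \<nu>\<eta> \<nu>\<epsilon> G C (X t \<omega>) (U t \<omega>) \<partial>M)"
  proof (rule nn_integral_cong)
    fix \<omega> assume "\<omega> \<in> space M"
    then have [measurable]: "X t \<omega> \<in> space MX" "U t \<omega> \<in> space MU"
      using measurable_space[OF X_rv[of t]] measurable_space[OF control_adapted[of t]] by auto
    show "(\<integral>\<^sup>+e. (\<integral>\<^sup>+v. ?g (\<omega>, e, v) \<partial>\<nu>\<epsilon>) \<partial>\<nu>\<eta>) =
        h \<omega> * controlled_kernel \<nu>\<eta> \<nu>\<epsilon> G C (X t \<omega>) (U t \<omega>)"
    proof -
      have "(\<integral>\<^sup>+e. (\<integral>\<^sup>+v. ?g (\<omega>, e, v) \<partial>\<nu>\<epsilon>) \<partial>\<nu>\<eta>) =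
          (\<integral>\<^sup>+e. h \<omega> * (\<integral>\<^sup>+v. indicator C (G (X t \<omega>, U t \<omega>, e, v)) \<partial>\<nu>\<epsilon>) \<partial>\<nu>\<eta>)"
      proof (rule nn_integral_cong)
        fix e assume "e \<in> space \<nu>\<eta>"
        then have [measurable]: "e \<in> space ME" using sets_eq_imp_space_eq[OF laws(1)] by simp
        show "(\<integral>\<^sup>+v. ?g (\<omega>, e, v) \<partial>\<nu>\<epsilon>) = h \<omega> * (\<integral>\<^sup>+v. indicator C (G (X t \<omega>, U t \<omega>, e, v)) \<partial>\<nu>\<epsilon>)"
          unfolding prod.case by (rule nn_integral_cmult) measurable
      qed
      also have "\<dots> = h \<omega> * controlled_kernel \<nu>\<eta> \<nu>\<epsilon> G C (X t \<omega>) (U t \<omega>)"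
        unfolding controlled_kernel_def by (rule nn_integral_cmult) measurable
      finally show ?thesis .
    qed
  qed
  also have "\<dots> = (\<integral>\<^sup>+\<omega>. (\<integral>\<^sup>+x. h \<omega> * controlled_kernel \<nu>\<eta> \<nu>\<epsilon> G C x (U t \<omega>) \<partial>\<pi> t \<omega>) \<partial>M)"
  proof -
    note h[measurable] control_adapted[of t, measurable] kernel_measurable[OF C, measurable]
    have "(\<lambda>(\<omega>, x). h \<omega> * controlled_kernel \<nu>\<eta> \<nu>\<epsilon> G C x (U t \<omega>)) \<in>
        borel_measurable (info t \<Otimes>\<^sub>M MX)" by measurable
    from filter_disintegration[OF this] show ?thesis by simp
  qed
  also have "\<dots> = (\<integral>\<^sup>+\<omega>. h \<omega> * predicted (U t \<omega>) (\<pi> t \<omega>) C \<partial>M)"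
  proof (rule nn_integral_cong)
    fix \<omega> assume \<omega>: "\<omega> \<in> space M"
    then have [measurable]: "U t \<omega> \<in> space MU"
      using measurable_space[OF control_adapted[of t]] by auto
    note filter_laws(2)[OF \<omega>, of t, measurable_cong] kernel_measurable[OF C, measurable]
    show "(\<integral>\<^sup>+x. h \<omega> * controlled_kernel \<nu>\<eta> \<nu>\<epsilon> G C x (U t \<omega>) \<partial>\<pi> t \<omega>) =
        h \<omega> * predicted (U t \<omega>) (\<pi> t \<omega>) C"
      unfolding predicted_law_def by (rule nn_integral_cmult) measurable
  qed
  finally show ?thesis .
qed

section \<open>Correction by the new observation\<close>

text \<open>Both sides, cut off to the event in question, are measurable for the information at time
  \<open>t + 1\<close>; they agree almost surely because they have the same integral over each of its events.
  Such an event may be replaced by an event of time \<open>t\<close>, so \<open>prediction\<close> evaluates both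
  integrals; on the right the probability of the new observation cancels the denominator.\<close>
lemma bayes_step:
  assumes j: "j \<in> cells" and C[measurable]: "C \<in> sets MX"
  shows "AE \<omega> in M. Y (Suc t) \<omega> = j \<and> predicted (U t \<omega>) (\<pi> t \<omega>) (cell j) > 0 \<longrightarrow>
    emeasure (\<pi> (Suc t) \<omega>) C =
      predicted (U t \<omega>) (\<pi> t \<omega>) (C \<inter> cell j) / predicted (U t \<omega>) (\<pi> t \<omega>) (cell j)"
proof -
  let ?H = "info t" and ?H' = "info (Suc t)"
  let ?R = "restr_to_subalg M ?H'"
  note sub = info_subalgebra[of "Suc t"]
  define N where "N \<omega> = predicted (U t \<omega>) (\<pi> t \<omega>) (C \<inter> cell j)" for \<omega>
  define D where "D \<omega> = predicted (U t \<omega>) (\<pi> t \<omega>) (cell j)" for \<omega>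
  define E where "E = {\<omega>\<in>space M. Y (Suc t) \<omega> = j \<and> D \<omega> > 0}"
  have cell[measurable]: "cell j \<in> sets MX" by (rule cell_measurable[OF j])
  have N: "N \<in> borel_measurable ?H" and D: "D \<in> borel_measurable ?H"
    unfolding N_def D_def by (intro predicted_measurable; measurable)+
  have D_fin: "D \<omega> < \<top>" if "\<omega> \<in> space M" for \<omega>
    using predicted_le_1[OF filter_laws(1)[OF that]] unfolding D_def
    by (rule le_less_trans) simp
  have lift: "f \<in> borel_measurable ?H'" if "f \<in> borel_measurable ?H" for f :: "'w \<Rightarrow> ennreal"
    using that by (intro measurable_from_subalg[of ?H' ?H]) (simp_all add: subalgebra_def info_mono)
  note ND[measurable] = lift[OF N] lift[OF D]
  have Y_j: "{\<omega>\<in>space M. Y (Suc t) \<omega> = j} \<in> sets ?H'"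
    unfolding sets_info by (intro sigma_sets.Basic) (auto intro!: exI[of _ "Suc t"] exI[of _ "{j}"])
  have "{\<omega>\<in>space ?H'. D \<omega> > 0} \<in> sets ?H'" by measurable
  from sets.Int[OF Y_j this] have E[measurable]: "E \<in> sets ?H'"
    by (rule back_subst[of "\<lambda>S. S \<in> sets ?H'"]) (auto simp: E_def)
  have em[measurable]: "(\<lambda>\<omega>. emeasure (\<pi> (Suc t) \<omega>) C) \<in> borel_measurable ?H'"
    by (rule measurable_emeasure_kernel[OF filter_subprob_kernel C])
  let ?f = "\<lambda>\<omega>. emeasure (\<pi> (Suc t) \<omega>) C * indicator E \<omega>"
  let ?f' = "\<lambda>\<omega>. N \<omega> / D \<omega> * indicator E \<omega>"
  have f: "?f \<in> borel_measurable ?H'" and f': "?f' \<in> borel_measurable ?H'" by measurable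
  interpret R: prob_space ?R
    by (rule prob_space_restr_to_subalg[OF sub]) (rule prob_space_axioms)
  have "AE \<omega> in ?R. ?f \<omega> = ?f' \<omega>"
  proof (rule R.density_unique_finite_measure)
    show "?f \<in> borel_measurable ?R" "?f' \<in> borel_measurable ?R"
      using f f' by (auto intro: measurable_in_subalg[OF sub])
    fix F assume "F \<in> sets ?R"
    then have F[measurable]: "F \<in> sets ?H'" by (simp add: sets_restr_to_subalg[OF sub])
    obtain F' where F'[measurable]: "F' \<in> sets ?H"
      and FF': "F \<inter> {\<omega>\<in>space M. Y (Suc t) \<omega> = j} = F' \<inter> {\<omega>\<in>space M. Y (Suc t) \<omega> = j}"
      by (rule info_next_on_observation[OF F])
    \<comment> \<open>The factor of the indicator of \<open>E \<inter> F\<close> that is known at time \<open>t\<close>; the other factor is the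
        indicator of the new observation.\<close>
    define h where "h \<omega> = indicator F' \<omega> * (indicator {\<omega>\<in>space ?H. D \<omega> > 0} \<omega> :: ennreal)" for \<omega>
    have h: "h \<in> borel_measurable ?H"
      unfolding h_def using D by measurable
    have hND: "(\<lambda>\<omega>. h \<omega> * (N \<omega> / D \<omega>)) \<in> borel_measurable ?H"
      using h N D by measurable
    have ind: "(indicator E \<omega> * indicator F \<omega> :: ennreal) = h \<omega> * indicator (cell j) (X (Suc t) \<omega>)"
      if "\<omega> \<in> space M" for \<omega>
    proof -
      have "\<omega> \<in> F \<longleftrightarrow> \<omega> \<in> F'" if "Y (Suc t) \<omega> = j" using FF' that \<open>\<omega> \<in> space M\<close> by blast
      then show ?thesis
        using that Y_iff[OF that j, of "Suc t"] by (auto simp: h_def E_def indicator_def)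
    qed
    have "(\<integral>\<^sup>+\<omega>. ?f \<omega> * indicator F \<omega> \<partial>?R) = (\<integral>\<^sup>+\<omega>\<in>E \<inter> F. emeasure (\<pi> (Suc t) \<omega>) C \<partial>M)"
      by (subst nn_integral_subalgebra2[OF sub])
         (auto intro!: nn_integral_cong simp: indicator_inter_arith mult.assoc)
    also have "\<dots> = emeasure M ((E \<inter> F) \<inter> (X (Suc t) -` C \<inter> space M))"
      by (rule filter_emeasure) measurable
    also have "\<dots> = (\<integral>\<^sup>+\<omega>. indicator ((E \<inter> F) \<inter> (X (Suc t) -` C \<inter> space M)) \<omega> \<partial>M)"
    proof -
      have "E \<inter> F \<in> sets M" using info_events[of "Suc t"] sets.Int[OF E F] by blast
      then show ?thesis by simp
    qed
    also have "\<dots> = (\<integral>\<^sup>+\<omega>. h \<omega> * indicator (C \<inter> cell j) (X (Suc t) \<omega>) \<partial>M)"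
    proof (rule nn_integral_cong)
      fix \<omega> assume "\<omega> \<in> space M"
      from ind[OF this] this
      show "indicator ((E \<inter> F) \<inter> (X (Suc t) -` C \<inter> space M)) \<omega> =
          h \<omega> * indicator (C \<inter> cell j) (X (Suc t) \<omega>)"
        by (auto simp: indicator_def split: if_splits)
    qed
    also have "\<dots> = (\<integral>\<^sup>+\<omega>. h \<omega> * N \<omega> \<partial>M)"
      unfolding N_def by (rule prediction[OF h]) measurable
    \<comment> \<open>Cancellation is legitimate: \<open>D\<close> is at most 1, and \<open>h\<close> vanishes where \<open>D\<close> does.\<close>
    also have "\<dots> = (\<integral>\<^sup>+\<omega>. h \<omega> * (N \<omega> / D \<omega>) * D \<omega> \<partial>M)"
    proof (rule nn_integral_cong)
      fix \<omega> assume \<omega>: "\<omega> \<in> space M"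
      have "N \<omega> / D \<omega> * D \<omega> = N \<omega>" if "D \<omega> > 0"
        using that D_fin[OF \<omega>] by (simp add: ennreal_divide_times ennreal_mult_divide_eq)
      then show "h \<omega> * N \<omega> = h \<omega> * (N \<omega> / D \<omega>) * D \<omega>"
        by (auto simp: h_def indicator_def mult.assoc)
    qed
    also have "\<dots> = (\<integral>\<^sup>+\<omega>. h \<omega> * (N \<omega> / D \<omega>) * indicator (cell j) (X (Suc t) \<omega>) \<partial>M)"
      unfolding D_def[of \<omega> for \<omega>] using prediction[OF hND cell] by (simp add: D_def)
    also have "\<dots> = (\<integral>\<^sup>+\<omega>. ?f' \<omega> * indicator F \<omega> \<partial>M)"
    proof (rule nn_integral_cong)
      fix \<omega> assume "\<omega> \<in> space M"
      from ind[OF this, symmetric]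
      have "N \<omega> / D \<omega> * (h \<omega> * indicator (cell j) (X (Suc t) \<omega>)) =
          N \<omega> / D \<omega> * (indicator E \<omega> * indicator F \<omega>)" by simp
      then show "h \<omega> * (N \<omega> / D \<omega>) * indicator (cell j) (X (Suc t) \<omega>) = ?f' \<omega> * indicator F \<omega>"
        by (simp only: ac_simps)
    qed
    also have "\<dots> = (\<integral>\<^sup>+\<omega>. ?f' \<omega> * indicator F \<omega> \<partial>?R)"
      by (rule nn_integral_subalgebra2[OF sub, symmetric]) measurable
    finally show "(\<integral>\<^sup>+\<omega>. ?f \<omega> * indicator F \<omega> \<partial>?R) = (\<integral>\<^sup>+\<omega>. ?f' \<omega> * indicator F \<omega> \<partial>?R)" .
  qed simp_all
  then have "AE \<omega> in M. ?f \<omega> = ?f' \<omega>" by (rule AE_restr_to_subalg[OF sub])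
  with AE_space show ?thesis
    by eventually_elim (auto simp: E_def N_def D_def)
qed

end

section \<open>Class-dependent density recursion\<close>

theorem corollary2:
  fixes M :: "'w measure" and MX :: "'x measure" and MU :: "'u measure"
    and ME :: "'e measure" and MV :: "'v measure"
    and G :: "'x \<times> 'u \<times> 'e \<times> 'v \<Rightarrow> 'x"
    and \<nu>\<eta> :: "'e measure" and \<nu>\<epsilon> :: "'v measure"
    and X :: "nat \<Rightarrow> 'w \<Rightarrow> 'x" and U :: "nat \<Rightarrow> 'w \<Rightarrow> 'u"
    and \<eta> :: "nat \<Rightarrow> 'w \<Rightarrow> 'e" and \<epsilon> :: "nat \<Rightarrow> 'w \<Rightarrow> 'v"
    and A :: "nat \<Rightarrow> 'x set" and m :: nat and J :: "nat \<Rightarrow> nat set" and r :: nat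
    and Y :: "nat \<Rightarrow> 'w \<Rightarrow> nat" and \<pi> :: "nat \<Rightarrow> 'w \<Rightarrow> 'x measure"
    and lam :: "nat \<Rightarrow> 'x measure" and q :: "nat \<Rightarrow> 'x \<times> 'x \<times> 'u \<Rightarrow> real"
    and t :: nat and j :: nat
  assumes model: "controlled_observation_model M MX MU ME MV G \<nu>\<eta> \<nu>\<epsilon> X U \<eta> \<epsilon> A m J r Y \<pi>"
    and lam_sets: "\<And>i. i \<in> class_indices MX A J r \<Longrightarrow> obs_class MX A J r i \<noteq> {} \<Longrightarrow>
        sets (lam i) = sets (restrict_space MX (obs_class MX A J r i))"
    and lam_sigma_finite: "\<And>i. i \<in> class_indices MX A J r \<Longrightarrow> obs_class MX A J r i \<noteq> {} \<Longrightarrow>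
        sigma_finite_measure (lam i)"
    and q_measurable: "\<And>i. i \<in> class_indices MX A J r \<Longrightarrow> obs_class MX A J r i \<noteq> {} \<Longrightarrow>
        q i \<in> borel_measurable (restrict_space MX (obs_class MX A J r i) \<Otimes>\<^sub>M MX \<Otimes>\<^sub>M MU)"
    and q_nonneg: "\<And>i x' x u. i \<in> class_indices MX A J r \<Longrightarrow> x' \<in> obs_class MX A J r i \<Longrightarrow>
        x \<in> space MX \<Longrightarrow> u \<in> space MU \<Longrightarrow> 0 \<le> q i (x', x, u)"
    and q_density: "\<And>i x u C. i \<in> class_indices MX A J r \<Longrightarrow> obs_class MX A J r i \<noteq> {} \<Longrightarrow>
        x \<in> space MX \<Longrightarrow> u \<in> space MU \<Longrightarrow> C \<in> sets MX \<Longrightarrow>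
        controlled_kernel \<nu>\<eta> \<nu>\<epsilon> G (C \<inter> obs_class MX A J r i) x u =
          (\<integral>\<^sup>+x'\<in>C \<inter> obs_class MX A J r i. ennreal (q i (x', x, u)) \<partial>(lam i))"
    and j: "j \<in> class_indices MX A J r"
  shows "(AE \<omega> in M.
            Y (t + 1) \<omega> = j \<and> predicted_law \<nu>\<eta> \<nu>\<epsilon> G (U t \<omega>) (\<pi> t \<omega>) (obs_class MX A J r j) > 0 \<longrightarrow>
            has_class_density (\<pi> (t + 1) \<omega>) (obs_class MX A J r j) (lam j)
              (norm_density (obs_class MX A J r j) (lam j) (q j) (\<pi> t \<omega>) (U t \<omega>))) \<and>
         (\<forall>k\<in>class_indices MX A J r. \<forall>\<omega>\<in>space M. \<forall>z.
            Y t \<omega> = k \<and> has_class_density (\<pi> t \<omega>) (obs_class MX A J r k) (lam k) z \<longrightarrow>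
            (\<forall>x'\<in>space MX.
               unnorm_density (obs_class MX A J r j) (q j) (\<pi> t \<omega>) (U t \<omega>) x' =
               indicator (obs_class MX A J r j) x' *
               (\<integral>\<^sup>+x\<in>obs_class MX A J r k. ennreal (q j (x', x, U t \<omega>)) * z x \<partial>(lam k))))"
proof (intro conjI ballI allI impI)
  interpret controlled_observation_model M MX MU ME MV G \<nu>\<eta> \<nu>\<epsilon> X U \<eta> \<epsilon> A m J r Y \<pi>
    by (rule model)
  note S = cell_measurable[OF j]
  have in_cell: "X s \<omega> \<in> cell i" if "\<omega> \<in> space M" "i \<in> cells" "Y s \<omega> = i" for s \<omega> i
    using Y_iff[OF that(1,2), of s] that(3) by simp
  have U_space: "U t \<omega> \<in> space MU" if "\<omega> \<in> space M" for \<omega>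
    using measurable_space[OF control_adapted[of t]] that by simp
  show "AE \<omega> in M. Y (t + 1) \<omega> = j \<and> predicted (U t \<omega>) (\<pi> t \<omega>) (cell j) > 0 \<longrightarrow>
      has_class_density (\<pi> (t + 1) \<omega>) (cell j) (lam j)
        (norm_density (cell j) (lam j) (q j) (\<pi> t \<omega>) (U t \<omega>))"
  proof (cases "cell j = {}")
    case True
    then have "Y (t + 1) \<omega> \<noteq> j" if "\<omega> \<in> space M" for \<omega>
      using in_cell[OF that j, of "t + 1"] by blast
    then show ?thesis by (intro AE_I2) blast
  next
    case False
    note lam = lam_sets[OF j False] lam_sigma_finite[OF j False] and q = q_measurable[OF j False]
    obtain P where P: "countable P" "Int_stable P" "P \<subseteq> Pow (space MX)" "space MX \<in> P"
      "sets MX = sigma_sets (space MX) P"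
      by (rule standard_borel_countable_generator[OF borel_X])
    have P_sets: "C \<in> sets MX" if "C \<in> P" for C using that P(5) by auto
    have "AE \<omega> in M. \<forall>C\<in>P. Y (Suc t) \<omega> = j \<and> predicted (U t \<omega>) (\<pi> t \<omega>) (cell j) > 0 \<longrightarrow>
        emeasure (\<pi> (Suc t) \<omega>) C =
          predicted (U t \<omega>) (\<pi> t \<omega>) (C \<inter> cell j) / predicted (U t \<omega>) (\<pi> t \<omega>) (cell j)"
      unfolding AE_ball_countable[OF P(1)] using bayes_step[OF j P_sets] by blast
    with AE_space show ?thesis
    proof eventually_elim
      case (elim \<omega>)
      let ?n = "unnorm_density (cell j) (q j) (\<pi> t \<omega>) (U t \<omega>)"
      let ?D = "\<integral>\<^sup>+y\<in>cell j. ?n y \<partial>lam j"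
      note \<mu> = filter_laws[OF elim(1), of t]
      note n = unnorm_density_measurable[OF S lam q \<mu>(3) U_space[OF elim(1)]]
      have trace: "C \<inter> cell j \<in> sets (lam j)" if "C \<in> sets MX" for C
        using that S by (auto simp: lam(1) sets_restrict_space)
      have pred: "predicted (U t \<omega>) (\<pi> t \<omega>) (C \<inter> cell j) = (\<integral>\<^sup>+x'\<in>C \<inter> cell j. ?n x' \<partial>lam j)"
        if C: "C \<in> sets MX" for C
        unfolding predicted_law_def
          nn_integral_unnorm_density[OF S lam q \<mu>(3) U_space[OF elim(1)] C]
        using sets_eq_imp_space_eq[OF \<mu>(2)] U_space[OF elim(1)]
        by (intro nn_integral_cong q_density[OF j False _ _ C]) simp_all
      have pred_cell: "predicted (U t \<omega>) (\<pi> t \<omega>) (cell j) = ?D"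
        using pred[OF S] by simp
      show ?case
      proof
        assume obs: "Y (t + 1) \<omega> = j \<and> predicted (U t \<omega>) (\<pi> t \<omega>) (cell j) > 0"
        show "has_class_density (\<pi> (t + 1) \<omega>) (cell j) (lam j)
            (norm_density (cell j) (lam j) (q j) (\<pi> t \<omega>) (U t \<omega>))"
        proof (rule has_class_density_if_generator[OF P(2-5) S lam(1)])
          show "\<pi> (t + 1) \<omega> \<in> space (prob_algebra MX)" using filter_laws[OF elim(1)] by blast
          show "norm_density (cell j) (lam j) (q j) (\<pi> t \<omega>) (U t \<omega>) \<in> borel_measurable (lam j)"
            unfolding norm_density_def using n by measurable
          fix C assume C: "C \<in> P"
          have "emeasure (\<pi> (t + 1) \<omega>) C = (\<integral>\<^sup>+x'\<in>C \<inter> cell j. ?n x' \<partial>lam j) / ?D"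
            using elim(2) C obs pred[OF P_sets[OF C]] pred_cell by simp
          also have "\<dots> = (\<integral>\<^sup>+x'. ?n x' * indicator (C \<inter> cell j) x' / ?D \<partial>lam j)"
            using n trace[OF P_sets[OF C]]
            by (intro nn_integral_divide[symmetric] borel_measurable_times_ennreal) simp_all
          also have "\<dots> = (\<integral>\<^sup>+x'\<in>C \<inter> cell j.
              norm_density (cell j) (lam j) (q j) (\<pi> t \<omega>) (U t \<omega>) x' \<partial>lam j)"
            by (simp add: norm_density_def divide_ennreal_def ac_simps)
          finally show "emeasure (\<pi> (t + 1) \<omega>) C = (\<integral>\<^sup>+x'\<in>C \<inter> cell j.
              norm_density (cell j) (lam j) (q j) (\<pi> t \<omega>) (U t \<omega>) x' \<partial>lam j)" .
        qed
      qed
    qed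
  qed
  fix k \<omega> z x'
  assume k: "k \<in> cells" and \<omega>: "\<omega> \<in> space M" and x': "x' \<in> space MX"
    and dens: "Y t \<omega> = k \<and> has_class_density (\<pi> t \<omega>) (cell k) (lam k) z"
  have k_ne: "cell k \<noteq> {}" using in_cell[OF \<omega> k] dens by blast
  have z: "z \<in> borel_measurable (lam k)" and law: "\<pi> t \<omega> = class_law MX (lam k) z"
    using dens has_class_density_iff[OF cell_measurable[OF k] lam_sets[OF k k_ne] filter_laws(2)[OF \<omega>]]
    by auto
  show "unnorm_density (cell j) (q j) (\<pi> t \<omega>) (U t \<omega>) x' =
      indicator (cell j) x' * (\<integral>\<^sup>+x\<in>cell k. ennreal (q j (x', x, U t \<omega>)) * z x \<partial>lam k)"
  proof (cases "x' \<in> cell j")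
    case True
    then have "cell j \<noteq> {}" by blast
    note q_measurable[OF j this, measurable]
    have [measurable]: "x' \<in> space (restrict_space MX (cell j))" "U t \<omega> \<in> space MU"
      using True x' U_space[OF \<omega>] by (simp_all add: space_restrict_space)
    have "(\<lambda>x. ennreal (q j (x', x, U t \<omega>))) \<in> borel_measurable MX" by measurable
    from nn_integral_class_law[OF cell_measurable[OF k] lam_sets[OF k k_ne] z this]
    show ?thesis by (simp add: unnorm_density_def law)
  qed (simp add: unnorm_density_def)
qed

end
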